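(* Let $0<\alpha<1$, $\lambda>0$, $k>0$, $q>0$, and let $C$ be a constant. Let $J(\mu)=\frac{\mu}{M_{\alpha/2}(\mu)}$ for $\mu>0$. Then there exists a unique $\tilde\mu$ such that $$J(\tilde\mu)=\frac{kq}{\lambda}\,\frac{\Gamma\left(1-\frac{\alpha}{2}\right)^2}{\Gamma\left(1+\frac{\alpha}{2}\right)},$$ and the solution of the fractional Stefan problem $$\begin{cases} D^\alpha u(x,t)=\lambda^2u_{xx}(x,t), & 0<x<s(t),\ t>0,\\ u_x(0,t)=-\dfrac{q}{t^{\alpha/2}}, & t>0,\\ u(s(t),t)=C, & t>0,\\ D^\alpha s(t)=-k\,u_x(s(t),t), & t>0,\\ s(0)=0\end{cases}$$ is given by $$u_2(x,t)=C+q\lambda\Gamma\left(1-\tfrac{\alpha}{2}\right)\left[1-W\left(-\tilde\mu,-\tfrac{\alpha}{2},1\right)\right]-q\lambda\Gamma\left(1-\tfrac{\alpha}{2}\right)\left[1-W\left(-\tfrac{x}{\lambda t^{\alpha/2}},-\tfrac{\alpha}{2},1\right)\right],$$ $$s_2(t)=\lambda\tilde\mu\,t^{\alpha/2}.$$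
   Context: The Wright function is $W(z,a,b)=\sum_{n=0}^{\infty}\frac{z^n}{n!\,\Gamma(an+b)}$, with $1/\Gamma=0$ at the poles of $\Gamma$. The Mainardi function is $M_\nu(z)=W(-z,-\nu,1-\nu)$. For $0<\alpha<1$, $D^\alpha f(t)=\frac{1}{\Gamma(1-\alpha)}\int_0^t (t-\tau)^{-\alpha}f'(\tau)\,d\tau$ is the Caputo derivative in $t$ with base point $0$. A pair $\{u,s\}$ is a solution of the problem if: (1) $u$ and $s$ satisfy all the conditions of the problem; (2) $u_{xx}$ and $D^\alpha u$ are continuous for $0<x<s(t)$, $0<t<T$; (3) $u$ and $u_x$ are continuous for $0\le x\le s(t)$, $0<t<T$; (4) $0\le\liminf_{x,t\to0^+}u(x,t)\le\limsup_{x,t\to0^+}u(x,t)<+\infty$; (5) $s$ is continuously differentiable in $[0,T)$ and $\frac{\dot s(\tau)}{(t-\tau)^\alpha}\in L^1(0,t)$ for all $t\in(0,T)$.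
   Formalization: "The solution is given by" is proved as: the pair is a solution; uniqueness of the pair is not claimed. In (5), s is only continuous on [0,T) and C^1 on (0,T), since s_2' blows up at 0. In (4), the lower bound 0 is claimed for C>=0 only; for any C the bound is C. *)

theory Defs
  imports "HOL-Analysis.Analysis"
begin

(* rGamma is the entire function 1/Gamma, equal to 0 at the poles of Gamma.
   The series converges absolutely for every z if a > -1. *)
definition wright :: "real \<Rightarrow> real \<Rightarrow> real \<Rightarrow> real" where
  "wright z a b = (\<Sum>n. z ^ n / fact n * rGamma (a * real n + b))"

definition mainardi :: "real \<Rightarrow> real \<Rightarrow> real" where
  "mainardi \<nu> z = wright (- z) (- \<nu>) (1 - \<nu>)"

definition stefan_J :: "real \<Rightarrow> real \<Rightarrow> real" where
  "stefan_J \<alpha> \<mu> = \<mu> / mainardi (\<alpha> / 2) \<mu>"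

definition caputo :: "real \<Rightarrow> (real \<Rightarrow> real) \<Rightarrow> real \<Rightarrow> real" where
  "caputo \<alpha> f t = 1 / Gamma (1 - \<alpha>) *
     (LINT \<tau>:{0<..<t}|lborel. (t - \<tau>) powr (- \<alpha>) * deriv f \<tau>)"

(* Guards against the default values of deriv and of the integral. *)
definition caputo_exists :: "real \<Rightarrow> (real \<Rightarrow> real) \<Rightarrow> real \<Rightarrow> bool" where
  "caputo_exists \<alpha> f t \<longleftrightarrow>
     (\<forall>\<tau>. 0 < \<tau> \<and> \<tau> < t \<longrightarrow> f field_differentiable (at \<tau>)) \<and>
     set_integrable lborel {0<..<t} (\<lambda>\<tau>. (t - \<tau>) powr (- \<alpha>) * deriv f \<tau>)"

(* Derivative in x on the closed liquid region: one-sided at x = 0 and at the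
   free boundary x = s t, two-sided in between. *)
definition space_deriv ::
  "(real \<Rightarrow> real) \<Rightarrow> (real \<Rightarrow> real \<Rightarrow> real) \<Rightarrow> real \<Rightarrow> real \<Rightarrow> real" where
  "space_deriv s u x t = vector_derivative (\<lambda>y. u y t) (at x within {0..s t})"

definition space_deriv2 ::
  "(real \<Rightarrow> real) \<Rightarrow> (real \<Rightarrow> real \<Rightarrow> real) \<Rightarrow> real \<Rightarrow> real \<Rightarrow> real" where
  "space_deriv2 s u x t = deriv (\<lambda>y. space_deriv s u y t) x"

(* The Caputo derivative of u x at time t has base point 0, so it uses u x \<tau>
   for all 0 < \<tau> < t, including times at which the point x is beyond the free
   boundary; u is therefore a function on the whole quadrant. *)
definition stefan_problem ::
  "real \<Rightarrow> real \<Rightarrow> real \<Rightarrow> real \<Rightarrow> real \<Rightarrow>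
   (real \<Rightarrow> real \<Rightarrow> real) \<Rightarrow> (real \<Rightarrow> real) \<Rightarrow> bool" where
  "stefan_problem \<alpha> l k q C u s \<longleftrightarrow>
     (\<forall>t>0. 0 < s t) \<and>
     (\<forall>t>0. (\<lambda>x. u x t) differentiable_on {0..s t}) \<and>
     (\<forall>t>0. \<forall>x. 0 < x \<and> x < s t \<longrightarrow>
        caputo_exists \<alpha> (u x) t \<and>
        (\<lambda>y. space_deriv s u y t) field_differentiable (at x) \<and>
        caputo \<alpha> (u x) t = l\<^sup>2 * space_deriv2 s u x t) \<and>
     (\<forall>t>0. space_deriv s u 0 t = - q / t powr (\<alpha> / 2)) \<and>
     (\<forall>t>0. u (s t) t = C) \<and>
     (\<forall>t>0. caputo_exists \<alpha> s t \<and>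
        caputo \<alpha> s t = - k * space_deriv s u (s t) t) \<and>
     s 0 = 0"

(* Solution on the time interval (0, T), with c as lower bound for the initial
   temperature.  The velocity of the boundary need only be continuous for
   positive times, with an integrable singularity allowed at 0: a boundary
   proportional to t powr (\<alpha> / 2) is not differentiable at 0. *)
definition stefan_solution_above ::
  "real \<Rightarrow> real \<Rightarrow> real \<Rightarrow> real \<Rightarrow> real \<Rightarrow> real \<Rightarrow> real \<Rightarrow>
   (real \<Rightarrow> real \<Rightarrow> real) \<Rightarrow> (real \<Rightarrow> real) \<Rightarrow> bool" where
  "stefan_solution_above c T \<alpha> l k q C u s \<longleftrightarrow>
     stefan_problem \<alpha> l k q C u s \<and>
     (let D = {(x, t). 0 < x \<and> x < s t \<and> 0 < t \<and> t < T};
          D' = {(x, t). 0 \<le> x \<and> x \<le> s t \<and> 0 < t \<and> t < T};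
          F = at (0, 0) within D
      in continuous_on D (\<lambda>(x, t). space_deriv2 s u x t) \<and>
         continuous_on D (\<lambda>(x, t). caputo \<alpha> (u x) t) \<and>
         continuous_on D' (\<lambda>(x, t). u x t) \<and>
         continuous_on D' (\<lambda>(x, t). space_deriv s u x t) \<and>
         ereal c \<le> Liminf F (\<lambda>(x, t). ereal (u x t)) \<and>
         Liminf F (\<lambda>(x, t). ereal (u x t)) \<le> Limsup F (\<lambda>(x, t). ereal (u x t)) \<and>
         Limsup F (\<lambda>(x, t). ereal (u x t)) < \<infinity>) \<and>
     continuous_on {0..<T} s \<and>
     (\<forall>t. 0 < t \<and> t < T \<longrightarrow> s field_differentiable (at t)) \<and>
     continuous_on {0<..<T} (deriv s) \<and>
     (\<forall>t. 0 < t \<and> t < T \<longrightarrow>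
        set_integrable lborel {0<..<t} (\<lambda>\<tau>. deriv s \<tau> / (t - \<tau>) powr \<alpha>))"

definition stefan_solution ::
  "real \<Rightarrow> real \<Rightarrow> real \<Rightarrow> real \<Rightarrow> real \<Rightarrow> real \<Rightarrow>
   (real \<Rightarrow> real \<Rightarrow> real) \<Rightarrow> (real \<Rightarrow> real) \<Rightarrow> bool" where
  "stefan_solution T \<alpha> l k q C u s \<longleftrightarrow> stefan_solution_above 0 T \<alpha> l k q C u s"

definition u2 :: "real \<Rightarrow> real \<Rightarrow> real \<Rightarrow> real \<Rightarrow> real \<Rightarrow> real \<Rightarrow> real \<Rightarrow> real" where
  "u2 \<alpha> l q C \<mu> x t =
     C + q * l * Gamma (1 - \<alpha> / 2) * (1 - wright (- \<mu>) (- \<alpha> / 2) 1)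
       - q * l * Gamma (1 - \<alpha> / 2) *
           (1 - wright (- x / (l * t powr (\<alpha> / 2))) (- \<alpha> / 2) 1)"

definition s2 :: "real \<Rightarrow> real \<Rightarrow> real \<Rightarrow> real \<Rightarrow> real" where
  "s2 \<alpha> l \<mu> t = l * \<mu> * t powr (\<alpha> / 2)"

end

theory Submission
  imports Defs "HOL-Complex_Analysis.Complex_Analysis" "HOL-Real_Asymp.Real_Asymp"
begin

text \<open>
  Put \<nu> = \<alpha> / 2, so that 0 < \<nu> < 1/2, and consider the function
  F_b(t) = t^(b-1) W(-x t^(-\<nu>), -\<nu>, b) for x > 0. Formally it is the inverse Laplace transform of
  p^(-b) exp(-x p^\<nu>), and almost everything needed about the candidate solution can be read off
  from this: multiplication by p^(-\<gamma>) turns F_0 into F_\<gamma>, which is the fractional equation;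
  and p^(-b) exp(-x p^\<nu>) is completely monotone for b \<ge> 0, which gives F_b \<ge> 0.

  The Laplace transform is found in two steps. Inserting the integral for 1/\<Gamma> coming from the
  reflection formula into the Wright series gives F_b(t) as an integral of exp(-ts) against the
  explicit function spectral, for b < 1 (wright_series_laplace). Since \<nu> < 1/2 this function
  is absolutely integrable over s > 0, so the Laplace transform of F_b is its Stieltjes transform.
  In the variable w = ln(s/p) that Stieltjes transform is the integral of a meromorphic function over
  the two edges of the strip of height 2\<pi>, whose only pole is w = 0; the residue is the value
  asserted (spectral_stieltjes). Passing back from transforms to functions uses the
  Post--Widder idea: integrating against the densities s^n exp(-ns/t) recovers the value at t, so
  the derivatives of the Laplace transform determine both the values and the sign of a bounded
  continuous function (nonneg_at_if_laplace_moments_nonneg).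

  Complete monotonicity for b = 1 - \<nu> and b = 1 - 2\<nu> shows that the Mainardi function M is
  nonnegative and nonincreasing on the positive axis, and it cannot reach 0, since otherwise
  F_(1-\<nu>) would vanish near t = 0 and its transform would decay exponentially, faster than
  exp(-p^\<nu>) (mainardi_pos). Hence J(\<mu>) = \<mu>/M(\<mu>) is strictly increasing from 0 to infinity and
  the equation for \<mu> has exactly one root.

  The similarity ansatz u = K + A W(-x/(\<lambda> t^\<nu>), -\<nu>, 1) then satisfies the equation because its time
  derivative is a multiple of F_0 and its second space derivative a multiple of F_(1-2\<nu>); the
  flux and temperature conditions fix A and K; and the condition at the free boundary is
  exactly J(\<mu>) = R. As the derivative of W(-z, -\<nu>, 1) is -M(z), the temperature decreases in x from the
  fixed face to the free boundary, which gives C as a lower bound for the initial temperature.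
\<close>

section \<open>The Wright series as a Laplace integral\<close>

lemma gamma_laplace:
  fixes a t :: real
  assumes "a > 0" "t > 0"
  shows "set_integrable lborel {0<..} (\<lambda>s. s powr (a - 1) * exp (- (t * s)))"
    and "(LINT s:{0<..}|lborel. s powr (a - 1) * exp (- (t * s))) = Gamma a / t powr a"
proof -
  have 1: "has_bochner_integral lborel (\<lambda>s. indicator {0..} s * s powr (a - 1) / exp s) (Gamma a)"
    using assms
    by (intro has_bochner_integral_nn_integral)
      (auto simp: Gamma_conv_nn_integral_real Gamma_real_nonneg)
  have 2: "has_bochner_integral lborel
      (\<lambda>s. indicator {0..} (0 + t * s) * (0 + t * s) powr (a - 1) / exp (0 + t * s)) (Gamma a / t)"
    using 1 assms(2) by (subst (asm) lborel_has_bochner_integral_real_affine_iff[of t _ _ 0])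
      (auto simp: divide_inverse mult.commute)
  have "has_bochner_integral lborel
      (\<lambda>s. inverse (t powr (a - 1)) *
         (indicator {0..} (0 + t * s) * (0 + t * s) powr (a - 1) / exp (0 + t * s)))
      (inverse (t powr (a - 1)) * (Gamma a / t))"
    by (intro has_bochner_integral_mult_right 2)
  also have "(\<lambda>s. inverse (t powr (a - 1)) *
         (indicator {0..} (0 + t * s) * (0 + t * s) powr (a - 1) / exp (0 + t * s)))
      = (\<lambda>s. indicator {0<..} s *\<^sub>R (s powr (a - 1) * exp (- (t * s))))"
  proof
    fix s :: real
    show "inverse (t powr (a - 1)) *
         (indicator {0..} (0 + t * s) * (0 + t * s) powr (a - 1) / exp (0 + t * s))
      = indicator {0<..} s *\<^sub>R (s powr (a - 1) * exp (- (t * s)))"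
      using assms by (cases "s > 0"; cases "s = 0")
        (auto simp: powr_mult exp_minus field_simps zero_le_mult_iff split: split_indicator)
  qed
  also have "inverse (t powr (a - 1)) * (Gamma a / t) = Gamma a / t powr a"
    using assms by (simp add: powr_diff field_simps)
  finally have 3: "has_bochner_integral lborel
    (\<lambda>s. indicator {0<..} s *\<^sub>R (s powr (a - 1) * exp (- (t * s)))) (Gamma a / t powr a)" .
  show "set_integrable lborel {0<..} (\<lambda>s. s powr (a - 1) * exp (- (t * s)))"
    using 3 by (auto simp: set_integrable_def has_bochner_integral_iff)
  show "(LINT s:{0<..}|lborel. s powr (a - 1) * exp (- (t * s))) = Gamma a / t powr a"
    using 3 by (auto simp: set_lebesgue_integral_def has_bochner_integral_iff)
qed

text \<open>
  Lets exp(-ts) absorb the factor exp(y s^\<nu>) that appears when the Wright series is summed with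
  absolute values.
\<close>

lemma linear_beats_powr:
  fixes \<nu> d y :: real
  assumes "0 < \<nu>" "\<nu> < 1" "d > 0" "y \<ge> 0"
  obtains K where "\<And>s. s > 0 \<Longrightarrow> y * s powr \<nu> \<le> d * s + K"
proof
  define R where "R = (y / d) powr (1 / (1 - \<nu>))"
  fix s :: real assume s: "s > 0"
  show "y * s powr \<nu> \<le> d * s + y * R powr \<nu>"
  proof (cases "s \<le> R")
    case True
    then have "y * s powr \<nu> \<le> y * R powr \<nu>"
      using s assms by (intro mult_left_mono powr_mono2) auto
    then show ?thesis using s assms by (smt (verit) mult_pos_pos)
  next
    case False
    then have "R powr (1 - \<nu>) \<le> s powr (1 - \<nu>)"
      using assms by (intro powr_mono2) (auto simp: R_def)
    then have "y / d \<le> s powr (1 - \<nu>)"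
      using assms by (auto simp: R_def powr_powr)
    then have "y \<le> d * s powr (1 - \<nu>)"
      using assms by (simp add: field_simps)
    then have "y * s powr \<nu> \<le> d * s powr (1 - \<nu>) * s powr \<nu>"
      by (intro mult_right_mono) auto
    also have "\<dots> = d * s"
      using s by (simp add: powr_add[symmetric])
    finally show ?thesis using assms by (smt (verit) mult_nonneg_nonneg powr_ge_zero)
  qed
qed

text \<open>
  The jump of p^(-b) exp(-x p^\<nu>) across its cut along the negative real axis, divided by 2\<pi>i; that
  is, the imaginary part at p = s exp(-i \<pi>), divided by \<pi>.
\<close>

definition spectral :: "real \<Rightarrow> real \<Rightarrow> real \<Rightarrow> real \<Rightarrow> real" where
  "spectral \<nu> b x s = s powr (- b) * exp (- (x * cos (pi * \<nu>) * s powr \<nu>))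
     * sin (pi * b + x * sin (pi * \<nu>) * s powr \<nu>) / pi"

lemma spectral_measurable [measurable]: "spectral \<nu> b x \<in> borel_measurable borel"
  unfolding spectral_def by measurable

text \<open>
  The imaginary part of s^(-b) exp(i \<pi> b) / \<pi> times the exponential series of
  -x s^\<nu> exp(-i \<pi> \<nu>).
\<close>

lemma spectral_sums:
  fixes \<nu> b x s :: real
  assumes "s > 0"
  shows "(\<lambda>n. (- x) ^ n / fact n * s powr (\<nu> * n - b) * (sin (pi * (b - \<nu> * n)) / pi))
    sums spectral \<nu> b x s"
proof -
  define z where "z = - (complex_of_real x) * s powr \<nu> * cis (- (pi * \<nu>))"
  define k where "k = (s powr (- b) / pi) *\<^sub>R cis (pi * b)"
  have "(\<lambda>n. Im (k * (z ^ n /\<^sub>R fact n))) sums Im (k * exp z)"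
    by (intro sums_Im sums_mult exp_converges)
  also have "Im (k * exp z) = spectral \<nu> b x s"
    by (simp add: k_def z_def exp_eq_polar spectral_def sin_add add_divide_distrib algebra_simps)
  also have "(\<lambda>n. Im (k * (z ^ n /\<^sub>R fact n))) =
    (\<lambda>n. (- x) ^ n / fact n * s powr (\<nu> * n - b) * (sin (pi * (b - \<nu> * n)) / pi))"
  proof
    fix n :: nat
    have "z = complex_of_real (- x) * (complex_of_real (s powr \<nu>) * cis (- (pi * \<nu>)))"
      by (simp add: z_def)
    then have "z ^ n = complex_of_real ((- x) ^ n * (s powr \<nu>) ^ n) * cis (- (pi * \<nu>)) ^ n"
      by (simp only: power_mult_distrib of_real_mult of_real_power mult.assoc)
    also have "\<dots> = complex_of_real ((- x) ^ n * s powr (\<nu> * n)) * cis (- (pi * \<nu> * n))"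
      using assms by (simp add: Complex.DeMoivre powr_power mult_ac)
    finally have "z ^ n = \<dots>" .
    then have "k * (z ^ n /\<^sub>R fact n) =
      (((- x) ^ n / fact n * s powr (\<nu> * n - b)) / pi) *\<^sub>R (cis (pi * b) * cis (- (pi * \<nu> * n)))"
      using assms by (simp add: k_def scaleR_conv_of_real powr_diff powr_minus field_simps)
    then show "Im (k * (z ^ n /\<^sub>R fact n)) =
      (- x) ^ n / fact n * s powr (\<nu> * n - b) * (sin (pi * (b - \<nu> * n)) / pi)"
      by (simp add: cis_mult algebra_simps)
  qed
  finally show ?thesis .
qed

text \<open>
  The Hankel representation of 1/\<Gamma> with the contour collapsed to the cut: the reflection formula
  trades 1/\<Gamma>(w) for the convergent Gamma integral at 1 - w. It also covers the poles of \<Gamma>,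
  where the sine vanishes.
\<close>

lemma rGamma_eq_integral:
  fixes w t :: real
  assumes "w < 1" "t > 0"
  shows "rGamma w * t powr (w - 1) =
    (LINT s:{0<..}|lborel. s powr (- w) * exp (- (t * s))) * (sin (pi * w) / pi)"
proof -
  have g: "Gamma (1 - w) \<noteq> 0" using Gamma_real_pos[of "1 - w"] assms by linarith
  have "complex_of_real (rGamma w * rGamma (1 - w)) =
      rGamma (complex_of_real w) * rGamma (1 - complex_of_real w)"
    using rGamma_complex_of_real[of w] rGamma_complex_of_real[of "1 - w"] by simp
  also have "\<dots> = complex_of_real (sin (pi * w) / pi)"
    by (subst rGamma_reflection_complex) (simp add: sin_of_real[symmetric])
  finally have "complex_of_real (rGamma w * rGamma (1 - w)) = complex_of_real (sin (pi * w) / pi)" .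
  then have "rGamma w * rGamma (1 - w) = sin (pi * w) / pi"
    using of_real_eq_iff by blast
  then have "rGamma w = Gamma (1 - w) * (sin (pi * w) / pi)"
    using g by (simp add: rGamma_inverse_Gamma[of "1 - w"] field_simps)
  moreover have "(LINT s:{0<..}|lborel. s powr (- w) * exp (- (t * s))) = Gamma (1 - w) / t powr (1 - w)"
    using gamma_laplace(2)[of "1 - w" t] assms by simp
  moreover have "t powr (w - 1) = 1 / t powr (1 - w)"
    using powr_minus[of t "1 - w"] by (simp add: divide_inverse)
  ultimately show ?thesis by simp
qed

text \<open>
  Each term of the Wright series becomes an integral, and summation and integration are exchanged by
  dominated convergence. The dominating function is integrable because \<nu> < 1, and the convergence
  of the Wright series is a by-product.
\<close>

lemma wright_series_laplace:
  fixes \<nu> b x t :: real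
  assumes "0 < \<nu>" "\<nu> < 1" "b < 1" "t > 0"
  shows "set_integrable lborel {0<..} (\<lambda>s. exp (- (t * s)) * spectral \<nu> b x s)"
    and "(\<lambda>n. (- x) ^ n / fact n * rGamma (b - \<nu> * n) * t powr (b - \<nu> * n - 1))
      sums (LINT s:{0<..}|lborel. exp (- (t * s)) * spectral \<nu> b x s)"
proof -
  define f where "f = (\<lambda>n s. indicator {0<..} s *\<^sub>R (exp (- (t * s)) *
    ((- x) ^ n / fact n * s powr (\<nu> * n - b) * (sin (pi * (b - \<nu> * n)) / pi))))"
  define h where "h = (\<lambda>n s. \<bar>x\<bar> ^ n / fact n * (indicator {0<..} s *\<^sub>R
    (s powr ((\<nu> * n - b + 1) - 1) * exp (- (t * s)))))"
  define H where "H = (\<lambda>s::real. indicator {0<..} s *\<^sub>R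
    (s powr (- b) * exp (\<bar>x\<bar> * s powr \<nu>) * exp (- (t * s))))"
  have pos: "\<nu> * real n - b + 1 > 0" for n
    using assms by (smt (verit) mult_nonneg_nonneg of_nat_0_le_iff)
  have int_h: "integrable lborel (h n)" for n
    unfolding h_def using gamma_laplace(1)[OF pos assms(4)]
    by (intro integrable_mult_right) (simp add: set_integrable_def)
  have h_nonneg: "h n s \<ge> 0" for n s unfolding h_def by (auto split: split_indicator)
  have f_meas: "f n \<in> borel_measurable lborel" for n unfolding f_def by measurable
  have f_le_h: "norm (f n s) \<le> h n s" for n s
  proof -
    have "\<bar>sin (pi * (b - \<nu> * n))\<bar> \<le> pi"
      using pi_ge_two abs_sin_le_one[of "pi * (b - \<nu> * n)"] by linarith
    then have "\<bar>sin (pi * (b - \<nu> * n)) / pi\<bar> \<le> 1"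
      by (simp add: abs_divide)
    then have "\<bar>(exp (- (t * s)) * (\<bar>x\<bar> ^ n / fact n * s powr (\<nu> * n - b))) * (sin (pi * (b - \<nu> * n)) / pi)\<bar>
      \<le> (exp (- (t * s)) * (\<bar>x\<bar> ^ n / fact n * s powr (\<nu> * n - b))) * 1"
      by (subst abs_mult, intro mult_mono) auto
    then show ?thesis
      by (auto simp: f_def h_def abs_mult power_abs mult_ac split: split_indicator)
  qed
  have int_f: "integrable lborel (f n)" for n
    by (rule Bochner_Integration.integrable_bound[OF int_h[of n] f_meas])
      (use f_le_h h_nonneg in auto)
  have h_sums: "(\<lambda>n. h n s) sums H s" for s
  proof (cases "s > 0")
    case True
    have "(\<lambda>n. (s powr (- b) * exp (- (t * s))) * ((\<bar>x\<bar> * s powr \<nu>) ^ n /\<^sub>R fact n)) sums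
       ((s powr (- b) * exp (- (t * s))) * exp (\<bar>x\<bar> * s powr \<nu>))"
      by (intro sums_mult exp_converges)
    moreover have "s powr ((\<nu> * n - b + 1) - 1) = s powr (- b) * (s powr \<nu>) ^ n" for n :: nat
      using True by (simp add: powr_power powr_add[symmetric] algebra_simps)
    ultimately show ?thesis using True
      by (simp add: h_def H_def power_mult_distrib mult_ac divide_inverse)
  qed (simp add: h_def H_def)
  obtain K where K: "\<And>s. s > 0 \<Longrightarrow> \<bar>x\<bar> * s powr \<nu> \<le> t / 2 * s + K"
    using linear_beats_powr[of \<nu> "t/2" "\<bar>x\<bar>"] assms by auto
  have int_H: "integrable lborel H"
  proof (rule Bochner_Integration.integrable_bound)
    show "integrable lborel (\<lambda>s. exp K * (indicator {0<..} s *\<^sub>R (s powr ((1 - b) - 1) * exp (- (t / 2 * s)))))"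
      using gamma_laplace(1)[of "1 - b" "t / 2"] assms
      by (intro integrable_mult_right) (simp add: set_integrable_def)
    show "H \<in> borel_measurable lborel" unfolding H_def by measurable
    show "AE s in lborel. norm (H s) \<le> norm (exp K * (indicator {0<..} s *\<^sub>R
        (s powr ((1 - b) - 1) * exp (- (t / 2 * s)))))"
    proof (rule AE_I2)
      fix s :: real
      show "norm (H s) \<le> norm (exp K * (indicator {0<..} s *\<^sub>R
        (s powr ((1 - b) - 1) * exp (- (t / 2 * s)))))"
      proof (cases "s > 0")
        case True
        have "exp (\<bar>x\<bar> * s powr \<nu>) * exp (- (t * s)) \<le> exp K * exp (- (t / 2 * s))"
          using K[OF True] by (simp add: exp_add[symmetric])
        then have "s powr (- b) * (exp (\<bar>x\<bar> * s powr \<nu>) * exp (- (t * s)))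
            \<le> s powr (- b) * (exp K * exp (- (t / 2 * s)))"
          by (intro mult_left_mono) auto
        then show ?thesis using True by (simp add: H_def abs_mult mult_ac)
      qed (simp add: H_def)
    qed
  qed
  have sum_h: "summable (\<lambda>n. \<integral>s. h n s \<partial>lborel)"
  proof (rule summableI_nonneg_bounded)
    show "0 \<le> (\<integral>s. h n s \<partial>lborel)" for n
      by (intro integral_nonneg_AE AE_I2 h_nonneg)
    show "(\<Sum>i<n. \<integral>s. h i s \<partial>lborel) \<le> (\<integral>s. H s \<partial>lborel)" for n
    proof -
      have "(\<Sum>i<n. \<integral>s. h i s \<partial>lborel) = (\<integral>s. (\<Sum>i<n. h i s) \<partial>lborel)"
        by (subst Bochner_Integration.integral_sum) (auto intro: int_h)
      also have "\<dots> \<le> (\<integral>s. H s \<partial>lborel)"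
      proof (intro integral_mono Bochner_Integration.integrable_sum int_h int_H)
        fix s
        show "(\<Sum>i<n. h i s) \<le> H s"
          using h_sums[of s] sum_le_suminf[of "\<lambda>n. h n s" "{..<n}"]
          by (simp add: h_nonneg sums_iff)
      qed
      finally show ?thesis .
    qed
  qed
  have sumf: "summable (\<lambda>n. norm (f n s))" for s
    by (rule summable_comparison_test'[OF sums_summable[OF h_sums[of s]], of 0])
      (use f_le_h in simp)
  have sumif: "summable (\<lambda>n. \<integral>s. norm (f n s) \<partial>lborel)"
  proof (rule summable_comparison_test'[OF sum_h])
    fix n :: nat
    have "(\<integral>s. norm (f n s) \<partial>lborel) \<le> (\<integral>s. h n s \<partial>lborel)"
      by (intro integral_mono integrable_norm int_f int_h f_le_h)
    then show "norm (\<integral>s. norm (f n s) \<partial>lborel) \<le> (\<integral>s. h n s \<partial>lborel)" by simp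
  qed
  have suminf_f: "(\<Sum>n. f n s) = indicator {0<..} s *\<^sub>R (exp (- (t * s)) * spectral \<nu> b x s)" for s
  proof (cases "s > 0")
    case True
    show ?thesis
      using True sums_mult[OF spectral_sums[OF True, of x \<nu> b], of "exp (- (t * s))"]
      by (simp add: f_def sums_iff)
  qed (simp add: f_def)
  show "set_integrable lborel {0<..} (\<lambda>s. exp (- (t * s)) * spectral \<nu> b x s)"
    using integrable_suminf[OF int_f _ sumif] sumf suminf_f
    by (simp add: set_integrable_def)
  have "(\<lambda>n. \<integral>s. f n s \<partial>lborel) sums (\<integral>s. (\<Sum>n. f n s) \<partial>lborel)"
    using sums_integral[OF int_f _ sumif] sumf by simp
  moreover have "(\<integral>s. f n s \<partial>lborel) =
      (- x) ^ n / fact n * rGamma (b - \<nu> * n) * t powr (b - \<nu> * n - 1)" for n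
  proof -
    have "f n = (\<lambda>s. ((- x) ^ n / fact n * (sin (pi * (b - \<nu> * n)) / pi)) *
       (indicator {0<..} s *\<^sub>R (s powr (- (b - \<nu> * n)) * exp (- (t * s)))))"
      by (auto simp: f_def mult_ac)
    then have "(\<integral>s. f n s \<partial>lborel) = ((- x) ^ n / fact n * (sin (pi * (b - \<nu> * n)) / pi)) *
       (LINT s:{0<..}|lborel. s powr (- (b - \<nu> * n)) * exp (- (t * s)))"
      by (simp only: set_lebesgue_integral_def integral_mult_right_zero)
    also have "\<dots> = (- x) ^ n / fact n * (rGamma (b - \<nu> * n) * t powr (b - \<nu> * n - 1))"
      by (subst rGamma_eq_integral) (use pos[of n] assms in auto)
    finally show ?thesis by simp
  qed
  ultimately show "(\<lambda>n. (- x) ^ n / fact n * rGamma (b - \<nu> * n) * t powr (b - \<nu> * n - 1))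
      sums (LINT s:{0<..}|lborel. exp (- (t * s)) * spectral \<nu> b x s)"
    by (simp add: suminf_f set_lebesgue_integral_def)
qed

section \<open>The Stieltjes transform of the spectral function\<close>

lemma set_integrable_lborel_iff_absolutely_integrable:
  fixes f :: "real \<Rightarrow> real"
  assumes [measurable]: "f \<in> borel_measurable borel" "S \<in> sets borel"
  shows "set_integrable lborel S f \<longleftrightarrow> f absolutely_integrable_on S"
  unfolding set_integrable_def by (rule integrable_completion[symmetric]) measurable

text \<open>
  The substitution s = r^(1/\<nu>) reduces this to a Gamma integral.
\<close>

lemma stretched_exponential_integrable:
  fixes a b \<nu> :: real
  assumes "a > 0" "b < 1" "\<nu> > 0"
  shows "set_integrable lborel {0<..} (\<lambda>s. s powr (- b) * exp (- (a * s powr \<nu>)))"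
proof -
  have im: "(\<lambda>r. r powr (1 / \<nu>)) ` {0<..} = {0<..}"
  proof (intro equalityI subsetI)
    fix s :: real assume "s \<in> {0<..}"
    then have "s = (s powr \<nu>) powr (1 / \<nu>)" "s powr \<nu> \<in> {0<..}"
      using assms by (auto simp: powr_powr)
    then show "s \<in> (\<lambda>r. r powr (1 / \<nu>)) ` {0<..}" by blast
  qed auto
  have inj: "inj_on (\<lambda>r::real. r powr (1 / \<nu>)) {0<..}"
    using assms by (intro inj_on_inverseI[of _ "\<lambda>s. s powr \<nu>"]) (simp add: powr_powr)
  have "set_integrable lborel {0<..} (\<lambda>r. 1 / \<nu> * (r powr ((1 - b) / \<nu> - 1) * exp (- (a * r))))"
    using assms by (intro set_integrable_mult_right gamma_laplace) auto
  also have "?this \<longleftrightarrow> set_integrable lborel {0<..} (\<lambda>r. \<bar>1 / \<nu> * r powr (1 / \<nu> - 1)\<bar> *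
      ((r powr (1 / \<nu>)) powr (- b) * exp (- (a * (r powr (1 / \<nu>)) powr \<nu>))))"
  proof (intro set_integrable_cong refl)
    fix r :: real assume "r \<in> {0<..}"
    then have r: "r > 0" by simp
    have "r powr ((1 - b) / \<nu> - 1) = r powr (1 / \<nu> - 1) * r powr (1 / \<nu> * (- b))"
      unfolding powr_add[symmetric] by (simp add: diff_divide_distrib algebra_simps)
    moreover have "(r powr (1 / \<nu>)) powr \<nu> = r"
      using r assms by (simp add: powr_powr)
    ultimately show "1 / \<nu> * (r powr ((1 - b) / \<nu> - 1) * exp (- (a * r))) =
      \<bar>1 / \<nu> * r powr (1 / \<nu> - 1)\<bar> *
      ((r powr (1 / \<nu>)) powr (- b) * exp (- (a * (r powr (1 / \<nu>)) powr \<nu>)))"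
      using assms by (simp add: powr_powr abs_mult)
  qed
  also have "\<dots> \<longleftrightarrow> (\<lambda>r. \<bar>1 / \<nu> * r powr (1 / \<nu> - 1)\<bar> *
      ((r powr (1 / \<nu>)) powr (- b) * exp (- (a * (r powr (1 / \<nu>)) powr \<nu>))))
      absolutely_integrable_on {0<..}"
    by (intro set_integrable_lborel_iff_absolutely_integrable) measurable
  also have "\<dots> \<longleftrightarrow> (\<lambda>s. s powr (- b) * exp (- (a * s powr \<nu>))) absolutely_integrable_on
      ((\<lambda>r. r powr (1 / \<nu>)) ` {0<..})"
    by (intro absolutely_integrable_change_of_variables_1'[symmetric] inj)
      (auto intro!: derivative_eq_intros)
  finally show ?thesis
    by (subst set_integrable_lborel_iff_absolutely_integrable) (auto simp: im)
qed

lemma spectral_bound: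
  assumes "s > 0"
  shows "\<bar>spectral \<nu> b x s\<bar> \<le> s powr (- b) * exp (- (x * cos (pi * \<nu>) * s powr \<nu>))"
proof -
  let ?g = "s powr (- b) * exp (- (x * cos (pi * \<nu>) * s powr \<nu>))"
  let ?\<theta> = "pi * b + x * sin (pi * \<nu>) * s powr \<nu>"
  have "\<bar>sin ?\<theta>\<bar> \<le> pi" using pi_ge_two abs_sin_le_one[of ?\<theta>] by linarith
  then have "?g * (\<bar>sin ?\<theta>\<bar> / pi) \<le> ?g * 1"
    by (intro mult_left_mono) auto
  then show ?thesis by (simp add: spectral_def abs_mult)
qed

lemma cos_pi_mult_pos: "0 < \<nu> \<Longrightarrow> \<nu> < 1 / 2 \<Longrightarrow> cos (pi * \<nu>) > 0" for \<nu> :: real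
  using mult_strict_left_mono[of \<nu> "1/2" pi] by (intro cos_gt_zero) auto

text \<open>
  Integrability at infinity, without any factor exp(-ts), is where \<nu> < 1/2 enters: it makes
  cos(\<pi> \<nu>) positive. This is what makes the functions F_b bounded up to t = 0.
\<close>

lemma spectral_integrable:
  assumes "0 < \<nu>" "\<nu> < 1 / 2" "b < 1" "x > 0"
  shows "set_integrable lborel {0<..} (spectral \<nu> b x)"
proof (rule set_integrable_bound)
  show "set_integrable lborel {0<..} (\<lambda>s. s powr (- b) * exp (- (x * cos (pi * \<nu>) * s powr \<nu>)))"
    using assms cos_pi_mult_pos[of \<nu>] by (intro stretched_exponential_integrable) auto
  show "set_borel_measurable lborel {0<..} (spectral \<nu> b x)"
    unfolding set_borel_measurable_def by measurable
qed (use spectral_bound in auto)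

lemma has_contour_integral_linepath_same_Im:
  assumes "a < b" "((\<lambda>v. f (Complex v c)) has_integral I) {a..b}"
  shows "(f has_contour_integral I) (linepath (Complex a c) (Complex b c))"
proof -
  have "((\<lambda>v. f (Complex ((b - a) * v + a) c)) has_integral (1 / \<bar>b - a\<bar>) *\<^sub>R I)
     ((\<lambda>v. (1 / (b - a)) *\<^sub>R v + - ((1 / (b - a)) *\<^sub>R a)) ` cbox a b)"
    using has_integral_affinity[of "\<lambda>v. f (Complex v c)" I a b "b - a" a] assms by simp
  also have "((\<lambda>v. (1 / (b - a)) *\<^sub>R v + - ((1 / (b - a)) *\<^sub>R a)) ` cbox a b) = {0..1}"
  proof -
    have "1 / (b - a) * b - 1 / (b - a) * a = 1"
      using assms(1) by (simp add: diff_divide_distrib[symmetric])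
    then show ?thesis
      using assms(1) image_affinity_cbox[of "1 / (b - a)" "- ((1 / (b - a)) *\<^sub>R a)" a b] by simp
  qed
  finally have "((\<lambda>v. (b - a) *\<^sub>R f (Complex ((b - a) * v + a) c)) has_integral (b - a) *\<^sub>R ((1 / \<bar>b - a\<bar>) *\<^sub>R I)) {0..1}"
    by (rule has_integral_cmul)
  then have "((\<lambda>v. f (linepath (Complex a c) (Complex b c) v) * (Complex b c - Complex a c))
      has_integral I) {0..1}"
  proof (rule has_integral_eq_rhs[OF has_integral_eq, rotated])
    fix v :: real
    have 1: "linepath (Complex a c) (Complex b c) v = Complex ((b - a) * v + a) c"
      by (simp add: linepath_def complex_eq_iff algebra_simps)
    have 2: "Complex b c - Complex a c = complex_of_real (b - a)"
      by (simp add: complex_eq_iff)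
    show "(b - a) *\<^sub>R f (Complex ((b - a) * v + a) c) =
      f (linepath (Complex a c) (Complex b c) v) * (Complex b c - Complex a c)"
      unfolding 1 2 by (simp add: scaleR_conv_of_real)
  qed (use assms in auto)
  then show ?thesis by (simp add: has_contour_integral_linepath)
qed

text \<open>
  With c = 1 - b and y = x p^\<nu>, this is the integrand of the Cauchy integral of
  z^(-b) exp(-x z^\<nu>) / (z - p) in the logarithmic variable z = p exp(w), up to the factor p^(-b). The
  plane cut along the negative axis becomes a strip, the numerator becomes entire, and a keyhole
  contour becomes a rectangle.
\<close>

definition strip_fun :: "real \<Rightarrow> real \<Rightarrow> real \<Rightarrow> complex \<Rightarrow> complex" where
  "strip_fun \<nu> c y w = exp (c * w - y * exp (\<nu> * w)) / (exp w - 1)"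

lemma exp_eq_1_in_strip: "\<bar>Im w\<bar> < 2 * pi \<Longrightarrow> exp w = 1 \<longleftrightarrow> w = 0"
proof
  assume *: "\<bar>Im w\<bar> < 2 * pi" "exp w = 1"
  then obtain n :: int where "Re w = 0" "Im w = of_int (2 * n) * pi"
    by (auto simp: exp_eq_1)
  moreover from this * have "\<bar>real_of_int n\<bar> < 1"
    by (simp add: abs_mult)
  then have "n = 0" by linarith
  ultimately show "w = 0" by (simp add: complex_eq_iff)
qed auto

lemma strip_rectangle:
  assumes "N > 0"
  shows "contour_integral (rectpath (Complex (- N) (- pi)) (Complex N pi)) (strip_fun \<nu> c y)
    = 2 * pi * \<i> * of_real (exp (- y))"
proof -
  define S where "S = {w. \<bar>Im w\<bar> < 2 * pi}"
  let ?g = "rectpath (Complex (- N) (- pi)) (Complex N pi)"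
  have S: "S = {w. Im w < 2 * pi} \<inter> {w. Im w > - (2 * pi)}" by (auto simp: S_def)
  have "open S" unfolding S
    by (intro open_Int open_halfspace_Im_lt open_halfspace_Im_gt)
  have "convex S" unfolding S
    by (intro convex_Int convex_halfspace_Im_lt convex_halfspace_Im_gt)
  have cb: "cbox (Complex (- N) (- pi)) (Complex N pi) \<subseteq> S"
    by (auto simp: S_def in_cbox_complex_iff abs_if pi_gt_zero less_le_trans[of 0])
      (use pi_gt_zero in linarith)+
  have holo: "strip_fun \<nu> c y holomorphic_on S - {0}"
    unfolding strip_fun_def
    by (intro holomorphic_intros) (use exp_eq_1_in_strip in \<open>auto simp: S_def\<close>)
  have pi: "path_image ?g = cbox (Complex (- N) (- pi)) (Complex N pi) - box (Complex (- N) (- pi)) (Complex N pi)"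
    using assms by (intro path_image_rectpath_cbox_minus_box) auto
  have 0: "0 \<in> box (Complex (- N) (- pi)) (Complex N pi)"
    using assms by (auto simp: in_box_complex_iff)
  have "residue (strip_fun \<nu> c y) 0 = exp (- y)"
  proof -
    have "residue (\<lambda>w. exp (c * w - y * exp (\<nu> * w)) / (exp w - 1)) 0
      = exp (complex_of_real c * 0 - complex_of_real y * exp (complex_of_real \<nu> * 0)) / 1"
    proof (rule residue_simple_pole_deriv[where s = UNIV])
      show "((\<lambda>w. exp w - 1) has_field_derivative 1) (at (0::complex))"
        by (auto intro!: derivative_eq_intros)
    qed (auto intro!: holomorphic_intros)
    then show ?thesis by (simp add: strip_fun_def[abs_def] exp_of_real[symmetric])
  qed
  moreover have "contour_integral ?g (strip_fun \<nu> c y) =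
     2 * pi * \<i> * (\<Sum>p\<in>{0}. winding_number ?g p * residue (strip_fun \<nu> c y) p)"
  proof (rule Residue_theorem[OF \<open>open S\<close>])
    show "connected S" using \<open>convex S\<close> by (rule convex_connected)
    show "path_image ?g \<subseteq> S - {0}" using cb 0 unfolding pi by blast
    show "\<forall>z. z \<notin> S \<longrightarrow> winding_number ?g z = 0"
      using cb assms by (intro allI impI winding_number_rectpath_outside) auto
  qed (use holo in auto)
  ultimately show ?thesis using winding_number_rectpath[OF 0] by simp
qed

lemma strip_fun_conj: "strip_fun \<nu> c y (cnj w) = cnj (strip_fun \<nu> c y w)"
  by (simp add: strip_fun_def exp_cnj)

text \<open>
  On the lower edge of the strip the factors exp(-i \<pi>) of numerator and denominator cancel and leave,
  up to scaling, the spectral function.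
\<close>

lemma strip_fun_bottom:
  "Im (strip_fun \<nu> (1 - b) y (Complex v (- pi))) =
    exp ((1 - b) * v) * exp (- (y * cos (pi * \<nu>) * exp (\<nu> * v)))
     * sin (pi * b + y * sin (pi * \<nu>) * exp (\<nu> * v)) / (1 + exp v)"
proof -
  have d: "exp (Complex v (- pi)) - 1 = - complex_of_real (1 + exp v)"
    by (simp add: exp_eq_polar cis.code complex_eq_iff)
  have e: "exp (\<nu> * Complex v (- pi)) = exp (\<nu> * v) *\<^sub>R cis (- (pi * \<nu>))"
    by (simp add: exp_eq_polar scaleR_conv_of_real mult_ac)
  have n: "exp ((1 - b) * Complex v (- pi) - y * exp (\<nu> * Complex v (- pi))) =
    - ((exp ((1 - b) * v) * exp (- (y * cos (pi * \<nu>) * exp (\<nu> * v)))) *\<^sub>R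
      cis (pi * b + y * sin (pi * \<nu>) * exp (\<nu> * v)))"
  proof -
    have "cis (- (1 - b) * pi + y * sin (pi * \<nu>) * exp (\<nu> * v)) =
       - cis (pi * b + y * sin (pi * \<nu>) * exp (\<nu> * v))"
    proof -
      have "cis (- (1 - b) * pi + y * sin (pi * \<nu>) * exp (\<nu> * v)) =
        cis (- pi) * cis (pi * b + y * sin (pi * \<nu>) * exp (\<nu> * v))"
        by (simp add: cis_mult algebra_simps)
      also have "cis (- pi) = -1" by (simp add: complex_eq_iff)
      finally show ?thesis by simp
    qed
    then show ?thesis
      unfolding e by (subst exp_eq_polar)
        (simp add: scaleR_conv_of_real exp_add exp_diff exp_minus field_simps)
  qed
  show ?thesis
    unfolding strip_fun_def n d minus_divide_divide by (simp del: of_real_add)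
qed

lemma strip_fun_right_bound:
  assumes "0 < \<nu>" "\<nu> < 1 / 2" "y > 0" "Re w = N" "N > 0" "\<bar>Im w\<bar> \<le> pi"
  shows "norm (strip_fun \<nu> c y w) \<le> exp (c * N - y * cos (pi * \<nu>) * exp (\<nu> * N)) / (exp N - 1)"
proof -
  have "\<bar>\<nu> * Im w\<bar> \<le> pi * \<nu>"
    using assms by (simp add: abs_mult mult.commute)
  moreover have "pi * \<nu> \<le> pi" using assms by simp
  ultimately have "cos (pi * \<nu>) \<le> cos \<bar>\<nu> * Im w\<bar>"
    by (intro cos_monotone_0_pi_le) auto
  then have "exp (\<nu> * N) * cos (pi * \<nu>) \<le> exp (\<nu> * N) * cos (\<nu> * Im w)"
    by (intro mult_left_mono) auto
  then have "y * (exp (\<nu> * N) * cos (pi * \<nu>)) \<le> y * (exp (\<nu> * N) * cos (\<nu> * Im w))"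
    using assms by (intro mult_left_mono) auto
  then have 1: "norm (exp (c * w - y * exp (\<nu> * w))) \<le> exp (c * N - y * cos (pi * \<nu>) * exp (\<nu> * N))"
    using assms by (simp add: norm_exp_eq_Re Re_exp mult_ac)
  have 2: "exp N - 1 \<le> norm (exp w - 1)"
    using norm_triangle_ineq2[of "exp w" 1] assms by (simp add: norm_exp_eq_Re)
  have 3: "exp N - 1 > 0" using assms by simp
  show ?thesis
    unfolding strip_fun_def norm_divide using 1 2 3 by (intro frac_le) auto
qed

lemma strip_fun_left_bound:
  assumes "0 < \<nu>" "\<nu> < 1 / 2" "y > 0" "Re w = - N" "N > 0" "\<bar>Im w\<bar> \<le> pi"
  shows "norm (strip_fun \<nu> c y w) \<le> exp (- (c * N)) / (1 - exp (- N))"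
proof -
  have "\<bar>\<nu> * Im w\<bar> \<le> \<nu> * pi"
    using assms by (simp add: abs_mult)
  also have "\<dots> < pi / 2"
    using mult_strict_right_mono[of \<nu> "1/2" pi] assms by simp
  finally have "cos (\<nu> * Im w) \<ge> 0" by (intro cos_ge_zero) auto
  then have 1: "norm (exp (c * w - y * exp (\<nu> * w))) \<le> exp (- (c * N))"
    using assms by (simp add: norm_exp_eq_Re Re_exp)
  have 2: "1 - exp (- N) \<le> norm (exp w - 1)"
    using norm_triangle_ineq2[of 1 "exp w"] assms by (simp add: norm_exp_eq_Re norm_minus_commute)
  have 3: "1 - exp (- N) > 0" using assms by simp
  show ?thesis
    unfolding strip_fun_def norm_divide using 1 2 3 by (intro frac_le) auto
qed

text \<open>
  The integrand takes conjugate values on the two horizontal sides of the rectangle, so together they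
  contribute 2i times the integral of the imaginary part; the error bound is the contribution of the
  two vertical sides.
\<close>

lemma strip_integral_estimate:
  assumes "0 < \<nu>" "\<nu> < 1 / 2" "y > 0" "N > 0"
  shows "\<bar>integral {- N..N} (\<lambda>v. Im (strip_fun \<nu> c y (Complex v (- pi)))) - pi * exp (- y)\<bar>
    \<le> pi * (exp (c * N - y * cos (pi * \<nu>) * exp (\<nu> * N)) / (exp N - 1)
       + exp (- (c * N)) / (1 - exp (- N)))"
proof -
  let ?f = "strip_fun \<nu> c y"
  let ?a1 = "Complex (- N) (- pi)" and ?a2 = "Complex N (- pi)"
    and ?a3 = "Complex N pi" and ?a4 = "Complex (- N) pi"
  let ?B2 = "exp (c * N - y * cos (pi * \<nu>) * exp (\<nu> * N)) / (exp N - 1)"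
  let ?B4 = "exp (- (c * N)) / (1 - exp (- N))"
  have cont: "continuous_on (- {w. exp w = 1}) ?f"
    unfolding strip_fun_def by (intro continuous_intros) auto
  have ne: "exp (Complex v t) \<noteq> 1" if "t = pi \<or> t = - pi \<or> (v = N \<or> v = - N) \<and> \<bar>t\<bar> \<le> pi" for v t
  proof -
    have "\<bar>t\<bar> \<le> pi" using that by auto
    then have "\<bar>t\<bar> < 2 * pi" using pi_gt_zero by linarith
    then show ?thesis
      using that assms exp_eq_1_in_strip[of "Complex v t"] by (auto simp: complex_eq_iff)
  qed
  define g where "g = (\<lambda>v. ?f (Complex v (- pi)))"
  have cg: "continuous_on {- N..N} g"
    unfolding g_def
  proof (rule continuous_on_compose2[OF cont])
    show "continuous_on {- N..N} (\<lambda>v. Complex v (- pi))"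
      unfolding Complex_eq by (intro continuous_intros)
    show "(\<lambda>v. Complex v (- pi)) ` {- N..N} \<subseteq> - {w. exp w = 1}"
      using ne by auto
  qed
  define G where "G = integral {- N..N} g"
  have hG: "(g has_integral G) {- N..N}"
    unfolding G_def by (intro integrable_integral integrable_continuous_real cg)
  have h1: "(?f has_contour_integral G) (linepath ?a1 ?a2)"
    using has_contour_integral_linepath_same_Im[of "- N" N ?f "- pi" G] hG assms by (simp add: g_def)
  have "((\<lambda>v. cnj (g v)) has_integral cnj G) {- N..N}"
    using has_integral_linear[OF hG bounded_linear_cnj] by (simp add: o_def)
  also have "(\<lambda>v. cnj (g v)) = (\<lambda>v. ?f (Complex v pi))"
    by (auto simp: g_def strip_fun_conj[symmetric] complex_cnj fun_eq_iff)
  finally have "(?f has_contour_integral cnj G) (linepath ?a4 ?a3)"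
    using has_contour_integral_linepath_same_Im[of "- N" N ?f "pi" "cnj G"] assms by simp
  then have h3: "(?f has_contour_integral (- cnj G)) (linepath ?a3 ?a4)"
    using has_contour_integral_reversepath[of "linepath ?a4 ?a3" ?f "cnj G"] by simp
  have seg: "x \<in> closed_segment (Complex r s) (Complex r t) \<Longrightarrow> Re x = r \<and> Im x \<in> closed_segment s t" for x r s t
    by (auto simp: closed_segment_same_Re)
  have c2: "continuous_on (closed_segment ?a2 ?a3) ?f"
  proof (rule continuous_on_subset[OF cont], safe)
    fix x assume "x \<in> closed_segment ?a2 ?a3" "exp x = 1"
    then have *: "Re x = N" "\<bar>Im x\<bar> \<le> pi" using seg[of x N "-pi" pi]
      by (auto simp: closed_segment_eq_real_ivl split: if_splits)
    have "exp (Complex (Re x) (Im x)) \<noteq> 1" by (rule ne) (use * in auto)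
    then show False using \<open>exp x = 1\<close> by simp
  qed
  have c4: "continuous_on (closed_segment ?a4 ?a1) ?f"
  proof (rule continuous_on_subset[OF cont], safe)
    fix x assume "x \<in> closed_segment ?a4 ?a1" "exp x = 1"
    then have *: "Re x = - N" "\<bar>Im x\<bar> \<le> pi" using seg[of x "-N" "pi" "-pi"]
      by (auto simp: closed_segment_eq_real_ivl split: if_splits)
    have "exp (Complex (Re x) (Im x)) \<noteq> 1" by (rule ne) (use * in auto)
    then show False using \<open>exp x = 1\<close> by simp
  qed
  define I2 I4 where "I2 = contour_integral (linepath ?a2 ?a3) ?f"
    and "I4 = contour_integral (linepath ?a4 ?a1) ?f"
  have h2: "(?f has_contour_integral I2) (linepath ?a2 ?a3)"
    unfolding I2_def by (intro has_contour_integral_integral contour_integrable_continuous_linepath c2)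
  have h4: "(?f has_contour_integral I4) (linepath ?a4 ?a1)"
    unfolding I4_def by (intro has_contour_integral_integral contour_integrable_continuous_linepath c4)
  have "(?f has_contour_integral (G + (I2 + (- cnj G + I4)))) (rectpath ?a1 ?a3)"
    unfolding rectpath_def Let_def
    using h1 h2 h3 h4 by (intro has_contour_integral_join) (auto intro!: valid_path_join)
  then have eq: "G + (I2 + (- cnj G + I4)) = 2 * pi * \<i> * of_real (exp (- y))"
    using strip_rectangle[of N \<nu> c y] assms contour_integral_unique by metis
  have b2: "norm I2 \<le> ?B2 * norm (?a3 - ?a2)"
  proof (rule has_contour_integral_bound_linepath[OF h2])
    fix x assume "x \<in> closed_segment ?a2 ?a3"
    then show "norm (?f x) \<le> ?B2" using seg[of x N "-pi" pi] assms
      by (intro strip_fun_right_bound) (auto simp: closed_segment_eq_real_ivl split: if_splits)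
  qed (use assms in auto)
  have b4: "norm I4 \<le> ?B4 * norm (?a1 - ?a4)"
  proof (rule has_contour_integral_bound_linepath[OF h4])
    fix x assume "x \<in> closed_segment ?a4 ?a1"
    then show "norm (?f x) \<le> ?B4" using seg[of x "-N" "pi" "-pi"] assms
      by (intro strip_fun_left_bound) (auto simp: closed_segment_eq_real_ivl split: if_splits)
  qed (use assms in auto)
  have n: "norm (?a3 - ?a2) = 2 * pi" "norm (?a1 - ?a4) = 2 * pi"
  proof -
    have "?a3 - ?a2 = of_real (2 * pi) * \<i>" "?a1 - ?a4 = - (of_real (2 * pi) * \<i>)"
      by (simp_all add: complex_eq_iff)
    then show "norm (?a3 - ?a2) = 2 * pi" "norm (?a1 - ?a4) = 2 * pi"
      by (simp_all add: norm_mult)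
  qed
  have "2 * Im G - 2 * (pi * exp (- y)) = - Im I2 - Im I4"
    using arg_cong[OF eq, of Im] by simp
  then have "2 * (Im G - pi * exp (- y)) = - Im I2 - Im I4" by simp
  then have "2 * \<bar>Im G - pi * exp (- y)\<bar> = \<bar>- Im I2 - Im I4\<bar>"
    by (metis abs_mult abs_numeral)
  also have "\<dots> \<le> \<bar>Im I2\<bar> + \<bar>Im I4\<bar>" using abs_triangle_ineq4[of "- Im I2" "Im I4"] by simp
  finally have "2 * \<bar>Im G - pi * exp (- y)\<bar> \<le> \<bar>Im I2\<bar> + \<bar>Im I4\<bar>" .
  also have "\<dots> \<le> norm I2 + norm I4" by (intro add_mono abs_Im_le_cmod)
  also have "\<dots> \<le> 2 * (pi * (?B2 + ?B4))"
    using b2 b4 unfolding n by (simp add: algebra_simps)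
  finally have "\<bar>Im G - pi * exp (- y)\<bar> \<le> pi * (?B2 + ?B4)" by simp
  moreover have "integral {- N..N} (\<lambda>v. Im (g v)) = Im G"
    using has_integral_linear[OF hG bounded_linear_Im] by (intro integral_unique) (simp add: o_def)
  ultimately show ?thesis by (simp add: g_def)
qed

lemma strip_integral_limit:
  assumes "0 < \<nu>" "\<nu> < 1 / 2" "y > 0" "c > 0"
  shows "(\<lambda>n. integral {- real (Suc n)..real (Suc n)} (\<lambda>v. Im (strip_fun \<nu> c y (Complex v (- pi)))))
    \<longlonglongrightarrow> pi * exp (- y)"
proof -
  have pos: "y * cos (pi * \<nu>) > 0" using assms cos_pi_mult_pos[of \<nu>] by simp
  have 1: "((\<lambda>N::real. exp (c * N - k * exp (\<nu> * N)) / (exp N - 1)) \<longlongrightarrow> 0) at_top" if "k > 0" for k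
    using assms that by real_asymp
  have 2: "((\<lambda>N::real. exp (- (c * N)) / (1 - exp (- N))) \<longlongrightarrow> 0) at_top"
    using assms by real_asymp
  define B where "B = (\<lambda>N. pi * (exp (c * N - y * cos (pi * \<nu>) * exp (\<nu> * N)) / (exp N - 1)
       + exp (- (c * N)) / (1 - exp (- N))))"
  have "(B \<longlongrightarrow> pi * (0 + 0)) at_top"
    unfolding B_def by (intro tendsto_intros 1 2 pos)
  moreover have "filterlim (\<lambda>n. real (Suc n)) at_top sequentially"
    using filterlim_compose[OF filterlim_real_sequentially filterlim_Suc] .
  ultimately have lim: "(\<lambda>n. B (real (Suc n))) \<longlonglongrightarrow> 0"
    using filterlim_compose by fastforce
  have "(\<lambda>n. integral {- real (Suc n)..real (Suc n)} (\<lambda>v. Im (strip_fun \<nu> c y (Complex v (- pi))))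
      - pi * exp (- y)) \<longlonglongrightarrow> 0"
  proof (rule Lim_null_comparison[OF _ lim], intro always_eventually allI)
    fix n
    show "norm (integral {- real (Suc n)..real (Suc n)} (\<lambda>v. Im (strip_fun \<nu> c y (Complex v (- pi))))
      - pi * exp (- y)) \<le> B (real (Suc n))"
      using strip_integral_estimate[OF assms(1-3), of "real (Suc n)" c]
      unfolding B_def real_norm_def by simp
  qed
  then show ?thesis by (simp only: LIM_zero_iff)
qed

text \<open>
  Letting the rectangle grow and substituting s = p exp(v).
\<close>

lemma spectral_stieltjes:
  fixes \<nu> b x p :: real
  assumes "0 < \<nu>" "\<nu> < 1 / 2" "b < 1" "x > 0" "p > 0"
  shows "set_integrable lborel {0<..} (\<lambda>s. spectral \<nu> b x s / (s + p))"
    and "(LINT s:{0<..}|lborel. spectral \<nu> b x s / (s + p)) = p powr (- b) * exp (- (x * p powr \<nu>))"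
proof -
  let ?f = "\<lambda>s. spectral \<nu> b x s / (s + p)"
  show int: "set_integrable lborel {0<..} ?f"
  proof (rule set_integrable_bound)
    show "set_integrable lborel {0<..} (\<lambda>s. spectral \<nu> b x s / p)"
      using spectral_integrable[OF assms(1-4)] by simp
    show "set_borel_measurable lborel {0<..} ?f"
      unfolding set_borel_measurable_def by measurable
    show "AE s in lborel. s \<in> {0<..} \<longrightarrow> norm (?f s) \<le> norm (spectral \<nu> b x s / p)"
      using assms by (auto intro!: divide_left_mono)
  qed
  define q where "q = (\<lambda>v. Im (strip_fun \<nu> (1 - b) (x * p powr \<nu>) (Complex v (- pi))))"
  have q: "\<bar>p * exp v\<bar> *\<^sub>R ?f (p * exp v) = p powr (- b) / pi * q v" for v
  proof -
    have "(p * exp v) powr (- b) = p powr (- b) * exp (- (b * v))"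
      using assms by (simp add: powr_mult exp_powr_real)
    moreover have "(p * exp v) powr \<nu> = p powr \<nu> * exp (\<nu> * v)"
      using assms by (simp add: powr_mult exp_powr_real mult.commute)
    moreover have "p * exp v + p = p * (1 + exp v)" by (simp add: algebra_simps)
    moreover have "exp ((1 - b) * v) = exp v * exp (- (b * v))"
      by (simp add: exp_add[symmetric] algebra_simps)
    moreover have "1 + exp v > 0" by (simp add: add_pos_pos)
    ultimately show ?thesis
      using assms by (simp add: q_def strip_fun_bottom spectral_def abs_mult mult_ac)
  qed
  have qm: "q \<in> borel_measurable borel"
    unfolding q_def strip_fun_bottom by measurable
  have im: "(\<lambda>v. p * exp v) ` UNIV = {0<..}"
  proof (intro equalityI subsetI)
    fix s :: real assume "s \<in> {0<..}"
    then have "s = p * exp (ln (s / p))" using assms by simp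
    then show "s \<in> range (\<lambda>v. p * exp v)" by blast
  qed (use assms in auto)
  have "?f absolutely_integrable_on ((\<lambda>v. p * exp v) ` UNIV) \<and> integral ((\<lambda>v. p * exp v) ` UNIV) ?f = integral {0<..} ?f"
    unfolding im using int by (subst (asm) set_integrable_lborel_iff_absolutely_integrable) auto
  then have cv: "(\<lambda>v. \<bar>p * exp v\<bar> *\<^sub>R ?f (p * exp v)) absolutely_integrable_on UNIV \<and>
      integral UNIV (\<lambda>v. \<bar>p * exp v\<bar> *\<^sub>R ?f (p * exp v)) = integral {0<..} ?f"
    using assms by (subst has_absolute_integral_change_of_variables_real)
      (auto intro!: derivative_eq_intros inj_onI)
  have abs: "(\<lambda>v. p powr (- b) / pi * q v) absolutely_integrable_on UNIV"
    using cv unfolding q by blast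
  have "(\<lambda>v. (pi / p powr (- b)) * (p powr (- b) / pi * q v)) absolutely_integrable_on UNIV"
    using abs by (rule set_integrable_mult_right)
  then have "q absolutely_integrable_on UNIV" using assms by simp
  then have iq: "set_integrable lborel UNIV q"
    using qm by (subst set_integrable_lborel_iff_absolutely_integrable) auto
  have un: "(\<Union>n. {- real (Suc n)..real (Suc n)}) = UNIV"
  proof (intro equalityI subsetI UNIV_I)
    fix v :: real
    obtain n where "\<bar>v\<bar> \<le> real n" using real_arch_simple by blast
    then show "v \<in> (\<Union>n. {- real (Suc n)..real (Suc n)})" by (auto intro!: exI[of _ n])
  qed
  have "(\<lambda>n. LINT v:{- real (Suc n)..real (Suc n)}|lborel. q v) \<longlonglongrightarrow>
      (LINT v:(\<Union>n. {- real (Suc n)..real (Suc n)})|lborel. q v)"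
  proof (rule set_integral_cont_up)
    show "set_integrable lborel (\<Union>n. {- real (Suc n)..real (Suc n)}) q"
      unfolding un by (rule iq)
  qed (auto simp: incseq_def)
  moreover have "(LINT v:{- real (Suc n)..real (Suc n)}|lborel. q v) =
      integral {- real (Suc n)..real (Suc n)} q" for n
    using iq by (intro set_borel_integral_eq_integral set_integrable_subset[OF iq]) auto
  moreover have "(\<lambda>n. integral {- real (Suc n)..real (Suc n)} q) \<longlonglongrightarrow> pi * exp (- (x * p powr \<nu>))"
    unfolding q_def using assms by (intro strip_integral_limit) auto
  ultimately have "(LINT v:UNIV|lborel. q v) = pi * exp (- (x * p powr \<nu>))"
    unfolding un by (metis (no_types, lifting) LIMSEQ_unique ext)
  then have "integral UNIV q = pi * exp (- (x * p powr \<nu>))"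
    using iq set_borel_integral_eq_integral(2) by metis
  moreover have "(LINT s:{0<..}|lborel. ?f s) = integral {0<..} ?f"
    using int by (rule set_borel_integral_eq_integral)
  ultimately show "(LINT s:{0<..}|lborel. ?f s) = p powr (- b) * exp (- (x * p powr \<nu>))"
    using cv unfolding q by simp
qed

section \<open>Sign and uniqueness from the Laplace transform\<close>

text \<open>
  Up to the sign (-1)^n, the n-th derivative of the Laplace transform of f.
\<close>

definition laplace_moment :: "(real \<Rightarrow> real) \<Rightarrow> nat \<Rightarrow> real \<Rightarrow> real" where
  "laplace_moment f n p = (LINT s:{0<..}|lborel. s ^ n * exp (- (p * s)) * f s)"

lemma power_exp_integral:
  fixes p :: real
  assumes "p > 0"
  shows "set_integrable lborel {0<..} (\<lambda>s. s ^ n * exp (- (p * s)))"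
    and "(LINT s:{0<..}|lborel. s ^ n * exp (- (p * s))) = fact n / p ^ Suc n"
proof -
  have eq: "s powr (real (Suc n) - 1) * exp (- (p * s)) = s ^ n * exp (- (p * s))" if "s \<in> {0<..}" for s
    using that by (simp add: powr_realpow)
  show "set_integrable lborel {0<..} (\<lambda>s. s ^ n * exp (- (p * s)))"
    using gamma_laplace(1)[of "real (Suc n)" p] assms eq
    by (subst (asm) set_integrable_cong[OF refl refl eq]) auto
  have "(LINT s:{0<..}|lborel. s ^ n * exp (- (p * s))) =
     (LINT s:{0<..}|lborel. s powr (real (Suc n) - 1) * exp (- (p * s)))"
    using eq by (intro set_lebesgue_integral_cong) auto
  also have "\<dots> = fact n / p ^ Suc n"
    using gamma_laplace(2)[of "real (Suc n)" p] assms Gamma_fact[of n, where 'a = real]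
    by (simp add: powr_realpow[symmetric] powr_add add.commute)
  finally show "(LINT s:{0<..}|lborel. s ^ n * exp (- (p * s))) = fact n / p ^ Suc n" .
qed

lemma laplace_moment_integrable:
  fixes f :: "real \<Rightarrow> real"
  assumes [measurable]: "f \<in> borel_measurable borel"
    and "\<And>s. s > 0 \<Longrightarrow> \<bar>f s\<bar> \<le> B" "p > 0"
  shows "set_integrable lborel {0<..} (\<lambda>s. s ^ n * exp (- (p * s)) * f s)"
proof (rule set_integrable_bound)
  show "set_integrable lborel {0<..} (\<lambda>s. s ^ n * exp (- (p * s)) * B)"
    using power_exp_integral(1)[OF assms(3)] by simp
  show "set_borel_measurable lborel {0<..} (\<lambda>s. s ^ n * exp (- (p * s)) * f s)"
    unfolding set_borel_measurable_def by measurable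
  have "\<bar>f s\<bar> \<le> \<bar>B\<bar>" if "s > 0" for s using assms(2)[OF that] by linarith
  then show "AE s in lborel. s \<in> {0<..} \<longrightarrow>
      norm (s ^ n * exp (- (p * s)) * f s) \<le> norm (s ^ n * exp (- (p * s)) * B)"
    by (auto simp: abs_mult intro!: mult_left_mono)
qed

text \<open>
  Sign part of the Post--Widder inversion. With p = n/t the weight s^n exp(-ps) is a multiple of a
  Gamma density of mean about t and variance about t^2/n. If f t were negative, f would
  lie below a parabola with negative value at t, and integrating the parabola only involves the first
  two moments of the density.
\<close>

lemma nonneg_at_if_laplace_moments_nonneg:
  fixes f :: "real \<Rightarrow> real"
  assumes meas: "f \<in> borel_measurable borel"
    and bound: "\<And>s. s > 0 \<Longrightarrow> \<bar>f s\<bar> \<le> B"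
    and t: "t > 0" and cont: "isCont f t"
    and mom: "\<And>n p. p > 0 \<Longrightarrow> laplace_moment f n p \<ge> 0"
  shows "f t \<ge> 0"
proof (rule ccontr)
  assume "\<not> f t \<ge> 0"
  define e where "e = - f t / 2"
  have e: "e > 0" using \<open>\<not> f t \<ge> 0\<close> by (simp add: e_def)
  have B: "B \<ge> 0" using bound[of 1] by simp
  obtain d where d: "d > 0" and near: "\<And>s. \<bar>s - t\<bar> < d \<Longrightarrow> \<bar>f s - f t\<bar> < e"
    using cont e unfolding continuous_at_eps_delta dist_real_def by blast
  \<comment> \<open>Chosen so that the parabola exceeds the bound B as soon as the distance from t is at least d.\<close>
  define K where "K = (B + e) / d\<^sup>2"
  have K: "K \<ge> 0" using B e by (simp add: K_def)
  have parabola: "f s \<le> K * (s - t)\<^sup>2 - e" if "s > 0" for s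
  proof (cases "\<bar>s - t\<bar> < d")
    case True
    have "f s < - e" using near[OF True] by (simp add: e_def abs_if split: if_splits)
    moreover have "K * (s - t)\<^sup>2 \<ge> 0" using K by simp
    ultimately show ?thesis by linarith
  next
    case False
    then have "d\<^sup>2 \<le> \<bar>s - t\<bar>\<^sup>2" using d by (intro power_mono) auto
    then have "K * d\<^sup>2 \<le> K * (s - t)\<^sup>2" using K by (intro mult_left_mono) auto
    moreover have "K * d\<^sup>2 = B + e" using d by (simp add: K_def)
    ultimately show ?thesis using bound[OF that] by linarith
  qed
  have main: "e \<le> K * t\<^sup>2 * (real n + 2) / (real n)\<^sup>2" if n: "n > 0" for n
  proof -
    define p where "p = real n / t"
    have p: "p > 0" using n t by (simp add: p_def)
    let ?w = "\<lambda>s. s ^ n * exp (- (p * s))"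
    let ?m = "\<lambda>j. LINT s:{0<..}|lborel. s ^ (n + j) * exp (- (p * s))"
    have i: "set_integrable lborel {0<..} (\<lambda>s. s ^ (n + j) * exp (- (p * s)))" for j
      using power_exp_integral(1)[OF p] .
    define Q where "Q = (\<lambda>s. K * (s ^ (n + 2) * exp (- (p * s)))
        - (2 * K * t) * (s ^ (n + 1) * exp (- (p * s))) + (K * t\<^sup>2 - e) * (s ^ (n + 0) * exp (- (p * s))))"
    have Q: "?w s * (K * (s - t)\<^sup>2 - e) = Q s" for s
      by (simp add: Q_def power2_eq_square algebra_simps)
    have iQ: "set_integrable lborel {0<..} Q"
      unfolding Q_def by (intro set_integral_add set_integral_diff set_integrable_mult_right i)
    have "0 \<le> laplace_moment f n p" by (rule mom[OF p])
    also have "\<dots> \<le> (LINT s:{0<..}|lborel. Q s)"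
      unfolding laplace_moment_def
    proof (rule set_integral_mono[OF _ iQ])
      show "set_integrable lborel {0<..} (\<lambda>s. ?w s * f s)"
        using laplace_moment_integrable[OF meas bound p] .
      fix s :: real assume "s \<in> {0<..}"
      then show "?w s * f s \<le> Q s"
        unfolding Q[symmetric] using parabola[of s] by (intro mult_left_mono) auto
    qed
    also have "\<dots> = K * ?m 2 - (2 * K * t) * ?m 1 + (K * t\<^sup>2 - e) * ?m 0"
      unfolding Q_def
      by (subst set_integral_add set_integral_diff;
          (intro set_integral_add set_integral_diff set_integrable_mult_right i)?)+
        (simp add: set_integral_mult_right)
    also have "\<dots> = fact n / p ^ Suc n * (K * t\<^sup>2 * (real n + 2) / (real n)\<^sup>2 - e)"
    proof -
      define A where "A = fact n / p ^ Suc n"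
      have m0: "?m 0 = A"
        using power_exp_integral(2)[OF p, of "n"] by (simp add: A_def)
      have m1: "?m 1 = A * ((n + 1) * t / n)"
        using power_exp_integral(2)[OF p, of "n + 1"] n t by (simp add: A_def p_def field_simps)
      have m2: "?m 2 = A * ((n + 1) * (n + 2) * t\<^sup>2 / (real n)\<^sup>2)"
        using power_exp_integral(2)[OF p, of "n + 2"] n t
        by (simp add: A_def p_def power2_eq_square field_simps)
      have "K * ?m 2 - (2 * K * t) * ?m 1 + (K * t\<^sup>2 - e) * ?m 0 =
        A * (K * ((n + 1) * (n + 2) * t\<^sup>2 / (real n)\<^sup>2)
          - 2 * K * t * ((n + 1) * t / n) + (K * t\<^sup>2 - e))"
        unfolding m0 m1 m2 by algebra
      also have "K * ((n + 1) * (n + 2) * t\<^sup>2 / (real n)\<^sup>2)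
          - 2 * K * t * ((n + 1) * t / n) + (K * t\<^sup>2 - e) = K * t\<^sup>2 * (real n + 2) / (real n)\<^sup>2 - e"
        using n by (simp add: field_simps power2_eq_square)
      finally show ?thesis unfolding A_def .
    qed
    finally have "0 \<le> fact n / p ^ Suc n * (K * t\<^sup>2 * (real n + 2) / (real n)\<^sup>2 - e)" .
    moreover have "fact n / p ^ Suc n > 0" using p by simp
    ultimately show ?thesis by (simp only: zero_le_mult_iff) linarith
  qed
  have "(\<lambda>n. K * t\<^sup>2 * (real n + 2) / (real n)\<^sup>2) \<longlonglongrightarrow> 0"
    by real_asymp
  then have "e \<le> 0"
    by (rule tendsto_lowerbound)
      (use main in \<open>auto simp: eventually_sequentially intro!: exI[of _ 1]\<close>)
  with e show False by simp
qed

lemma exp_diff_quotient_bound: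
  fixes a p s c :: real
  assumes "a > c" "p > c" "a \<noteq> p" "s > 0"
  shows "\<bar>(exp (- (a * s)) - exp (- (p * s))) / (a - p)\<bar> \<le> s * exp (- (c * s))"
proof -
  have *: "\<bar>exp (- (v * s)) - exp (- (u * s))\<bar> \<le> (v - u) * (s * exp (- (c * s)))"
    if "c < u" "u < v" for u v
  proof -
    have "1 - exp (- ((v - u) * s)) \<le> (v - u) * s"
      using exp_ge_add_one_self[of "- ((v - u) * s)"] by linarith
    then have "exp (- (u * s)) * (1 - exp (- ((v - u) * s))) \<le> exp (- (c * s)) * ((v - u) * s)"
      using that assms by (intro mult_mono) auto
    moreover have "exp (- (u * s)) * (1 - exp (- ((v - u) * s))) = exp (- (u * s)) - exp (- (v * s))"
      by (simp add: algebra_simps exp_add[symmetric])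
    moreover have "exp (- (v * s)) \<le> exp (- (u * s))" using that assms by simp
    ultimately show ?thesis by (simp add: mult_ac)
  qed
  have "\<bar>exp (- (a * s)) - exp (- (p * s))\<bar> \<le> \<bar>a - p\<bar> * (s * exp (- (c * s)))"
    using *[of a p] *[of p a] assms by (cases "a < p") (auto simp: abs_minus_commute)
  then show ?thesis using assms by (simp add: abs_divide divide_le_eq mult_ac)
qed

text \<open>
  Differentiation under the integral sign, by dominated convergence along sequences; restricting to
  arguments above p/2 gives a common dominating function.
\<close>

lemma laplace_moment_deriv:
  fixes f :: "real \<Rightarrow> real"
  assumes [measurable]: "f \<in> borel_measurable borel"
    and bound: "\<And>s. s > 0 \<Longrightarrow> \<bar>f s\<bar> \<le> B" and p: "p > 0"
  shows "(laplace_moment f n has_real_derivative - laplace_moment f (Suc n) p) (at p)"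
proof -
  have "(laplace_moment f n has_real_derivative - laplace_moment f (Suc n) p) (at p within {p/2<..})"
    unfolding has_field_derivative_iff
  proof (subst tendsto_at_iff_sequentially, intro allI impI)
    fix X :: "nat \<Rightarrow> real"
    assume X: "\<forall>i. X i \<in> {p / 2<..} - {p}" and lim: "X \<longlonglongrightarrow> p"
    have Xp: "X i > p / 2" "X i \<noteq> p" "X i > 0" for i
      using X p by (auto dest!: spec[of _ i])
    define Q where "Q = (\<lambda>i s. indicator {0<..} s *\<^sub>R
      (s ^ n * ((exp (- (X i * s)) - exp (- (p * s))) / (X i - p)) * f s))"
    have eq: "(laplace_moment f n (X i) - laplace_moment f n p) / (X i - p) = (\<integral>s. Q i s \<partial>lborel)" for i
    proof -
      have "laplace_moment f n (X i) - laplace_moment f n p =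
        (LINT s:{0<..}|lborel. s ^ n * exp (- (X i * s)) * f s - s ^ n * exp (- (p * s)) * f s)"
        unfolding laplace_moment_def
        by (intro set_integral_diff(2)[symmetric] laplace_moment_integrable[where B = B])
          (use bound p Xp in auto)
      then have "(laplace_moment f n (X i) - laplace_moment f n p) / (X i - p) =
        (LINT s:{0<..}|lborel. (s ^ n * exp (- (X i * s)) * f s - s ^ n * exp (- (p * s)) * f s) / (X i - p))"
        by simp
      also have "\<dots> = (\<integral>s. Q i s \<partial>lborel)"
        unfolding set_lebesgue_integral_def Q_def
        by (intro Bochner_Integration.integral_cong refl) (simp add: algebra_simps diff_divide_distrib)
      finally show ?thesis .
    qed
    have "(\<lambda>i. \<integral>s. Q i s \<partial>lborel) \<longlonglongrightarrow>
      (\<integral>s. indicator {0<..} s *\<^sub>R (s ^ n * (- (s * exp (- (p * s)))) * f s) \<partial>lborel)"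
    proof (rule integral_dominated_convergence)
      show "integrable lborel (\<lambda>s. indicator {0<..} s *\<^sub>R (s ^ Suc n * exp (- (p / 2 * s)) * \<bar>B\<bar>))"
        using power_exp_integral(1)[of "p/2" "Suc n"] p
        unfolding set_integrable_def[symmetric] by (intro set_integrable_mult_left) auto
      show "AE s in lborel. (\<lambda>i. Q i s) \<longlonglongrightarrow>
          indicator {0<..} s *\<^sub>R (s ^ n * (- (s * exp (- (p * s)))) * f s)"
      proof (intro AE_I2)
        fix s :: real
        have "((\<lambda>a. exp (- (a * s))) has_real_derivative - (s * exp (- (p * s)))) (at p)"
          by (auto intro!: derivative_eq_intros)
        then have "((\<lambda>a. (exp (- (a * s)) - exp (- (p * s))) / (a - p)) \<longlongrightarrow> - (s * exp (- (p * s)))) (at p)"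
          by (simp add: has_field_derivative_iff)
        then have "(\<lambda>i. (exp (- (X i * s)) - exp (- (p * s))) / (X i - p)) \<longlonglongrightarrow> - (s * exp (- (p * s)))"
          by (rule filterlim_compose) (use lim Xp in \<open>auto simp: filterlim_at\<close>)
        then show "(\<lambda>i. Q i s) \<longlonglongrightarrow>
          indicator {0<..} s *\<^sub>R (s ^ n * (- (s * exp (- (p * s)))) * f s)"
          unfolding Q_def by (intro tendsto_intros)
      qed
      show "AE s in lborel. norm (Q i s) \<le> indicator {0<..} s *\<^sub>R (s ^ Suc n * exp (- (p / 2 * s)) * \<bar>B\<bar>)" for i
      proof (intro AE_I2)
        fix s :: real
        show "norm (Q i s) \<le> indicator {0<..} s *\<^sub>R (s ^ Suc n * exp (- (p / 2 * s)) * \<bar>B\<bar>)"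
        proof (cases "s > 0")
          case True
          have "\<bar>(exp (- (X i * s)) - exp (- (p * s))) / (X i - p)\<bar> \<le> s * exp (- (p / 2 * s))"
            using Xp[of i] True p by (intro exp_diff_quotient_bound) auto
          moreover have "\<bar>f s\<bar> \<le> \<bar>B\<bar>" using bound[OF True] by linarith
          ultimately have "s ^ n * \<bar>(exp (- (X i * s)) - exp (- (p * s))) / (X i - p)\<bar> * \<bar>f s\<bar>
             \<le> s ^ n * (s * exp (- (p / 2 * s))) * \<bar>B\<bar>"
            using True by (intro mult_mono mult_nonneg_nonneg) auto
          then show ?thesis using True by (simp add: Q_def abs_mult mult_ac)
        qed (simp add: Q_def)
      qed
      show "Q i \<in> borel_measurable lborel" for i unfolding Q_def by measurable
    qed measurable
    also have "(\<integral>s. indicator {0<..} s *\<^sub>R (s ^ n * (- (s * exp (- (p * s)))) * f s) \<partial>lborel)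
      = - laplace_moment f (Suc n) p"
      unfolding laplace_moment_def set_lebesgue_integral_def
      by (simp add: mult.assoc mult.left_commute)
    finally show "((\<lambda>y. (laplace_moment f n y - laplace_moment f n p) / (y - p)) \<circ> X)
        \<longlonglongrightarrow> - laplace_moment f (Suc n) p"
      by (simp add: o_def eq)
  qed
  moreover have "at p within {p/2<..} = at p"
    by (rule at_within_open) (use p in auto)
  ultimately show ?thesis by simp
qed

lemma laplace_moment_Suc_eq:
  fixes f :: "real \<Rightarrow> real"
  assumes "f \<in> borel_measurable borel" "\<And>s. s > 0 \<Longrightarrow> \<bar>f s\<bar> \<le> B" "p > 0"
    and "\<And>r. r > 0 \<Longrightarrow> laplace_moment f n r = h r"
    and "(h has_real_derivative - d) (at p)"
  shows "laplace_moment f (Suc n) p = d"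
proof -
  have "(h has_real_derivative - laplace_moment f (Suc n) p) (at p)"
    by (rule has_field_derivative_transform_within_open[OF laplace_moment_deriv[OF assms(1-3), of n], of "{0<..}"])
      (use assms in auto)
  from DERIV_unique[OF this assms(5)] show ?thesis by simp
qed

text \<open>
  A vanishing Laplace transform has vanishing derivatives, so the sign criterion applies to f and to
  its negative.
\<close>

lemma laplace_unique_at:
  fixes f :: "real \<Rightarrow> real"
  assumes meas: "f \<in> borel_measurable borel" and bound: "\<And>s. s > 0 \<Longrightarrow> \<bar>f s\<bar> \<le> B"
    and t: "t > 0" and cont: "isCont f t"
    and zero: "\<And>p. p > 0 \<Longrightarrow> laplace_moment f 0 p = 0"
  shows "f t = 0"
proof -
  have z: "laplace_moment f n p = 0" if "p > 0" for n p
    using that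
  proof (induction n arbitrary: p)
    case (Suc n)
    show ?case
      by (rule laplace_moment_Suc_eq[OF meas bound Suc.prems, where h = "\<lambda>_. 0"])
        (use Suc.IH in auto)
  qed (use zero in auto)
  have "f t \<ge> 0"
    by (rule nonneg_at_if_laplace_moments_nonneg[OF meas bound t cont]) (auto simp: z)
  moreover have "- f t \<ge> 0"
  proof (rule nonneg_at_if_laplace_moments_nonneg[where f = "\<lambda>s. - f s" and B = B])
    show "laplace_moment (\<lambda>s. - f s) n p \<ge> 0" if "p > 0" for n p
      using z[OF that, of n] by (simp add: laplace_moment_def set_lebesgue_integral_def)
  qed (use meas bound t cont in auto)
  ultimately show ?thesis by simp
qed

text \<open>
  A cone of nonnegative functions closed under minus the derivative when 0 < \<nu> < 1 and x > 0; this exhibits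
  complete monotonicity of p^(-b) exp(-x p^\<nu>) for b \<ge> 0 without computing higher derivatives.
\<close>

inductive stable_cm :: "real \<Rightarrow> real \<Rightarrow> (real \<Rightarrow> real) \<Rightarrow> bool" for \<nu> x where
  atom: "a \<ge> 0 \<Longrightarrow> c \<ge> 0 \<Longrightarrow> stable_cm \<nu> x (\<lambda>p. a * (p powr (- c) * exp (- (x * p powr \<nu>))))"
| add: "stable_cm \<nu> x g \<Longrightarrow> stable_cm \<nu> x h \<Longrightarrow> stable_cm \<nu> x (\<lambda>p. g p + h p)"

lemma stable_cm_nonneg: "stable_cm \<nu> x h \<Longrightarrow> h p \<ge> 0"
  by (induction rule: stable_cm.induct) auto

lemma stable_cm_deriv:
  assumes "stable_cm \<nu> x h" "0 < \<nu>" "\<nu> < 1" "x > 0"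
  shows "\<exists>g. stable_cm \<nu> x g \<and> (\<forall>p>0. (h has_real_derivative - g p) (at p))"
  using assms(1)
proof induction
  case (atom a c)
  let ?g = "\<lambda>p. (a * c) * (p powr (- (c + 1)) * exp (- (x * p powr \<nu>)))
    + (a * x * \<nu>) * (p powr (- (c + 1 - \<nu>)) * exp (- (x * p powr \<nu>)))"
  have "stable_cm \<nu> x ?g"
    using atom assms by (intro stable_cm.intros) auto
  moreover have "((\<lambda>p. a * (p powr (- c) * exp (- (x * p powr \<nu>)))) has_real_derivative - ?g p) (at p)"
    if p: "p > 0" for p
  proof -
    have e: "p powr (- (c + 1 - \<nu>)) = p powr (- c) * p powr (\<nu> - 1)"
      "p powr (- (c + 1)) = p powr (- c - 1)"
      unfolding powr_add[symmetric] by (rule arg_cong; simp)+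
    show ?thesis
      unfolding e using p by (auto intro!: derivative_eq_intros simp: algebra_simps)
  qed
  ultimately show ?case by blast
next
  case (add g h)
  then obtain g' h' where "stable_cm \<nu> x g'" "\<forall>p>0. (g has_real_derivative - g' p) (at p)"
    "stable_cm \<nu> x h'" "\<forall>p>0. (h has_real_derivative - h' p) (at p)" by blast
  then have "stable_cm \<nu> x (\<lambda>p. g' p + h' p)"
    "\<forall>p>0. ((\<lambda>p. g p + h p) has_real_derivative - (g' p + h' p)) (at p)"
    by (auto intro!: stable_cm.intros derivative_eq_intros)
  then show ?case by blast
qed

lemma nonneg_if_laplace_stable:
  fixes f :: "real \<Rightarrow> real"
  assumes meas: "f \<in> borel_measurable borel" and bound: "\<And>s. s > 0 \<Longrightarrow> \<bar>f s\<bar> \<le> B"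
    and t: "t > 0" and cont: "isCont f t"
    and \<nu>: "0 < \<nu>" "\<nu> < 1" and x: "x > 0" and b: "b \<ge> 0"
    and lap: "\<And>p. p > 0 \<Longrightarrow> laplace_moment f 0 p = p powr (- b) * exp (- (x * p powr \<nu>))"
  shows "f t \<ge> 0"
proof (rule nonneg_at_if_laplace_moments_nonneg[OF meas bound t cont])
  have ex: "\<exists>h. stable_cm \<nu> x h \<and> (\<forall>p>0. laplace_moment f n p = h p)" for n
  proof (induction n)
    case 0
    show ?case using stable_cm.atom[of 1 b \<nu> x] b lap by auto
  next
    case (Suc n)
    then obtain h where h: "stable_cm \<nu> x h" "\<And>p. p > 0 \<Longrightarrow> laplace_moment f n p = h p" by blast
    obtain g where g: "stable_cm \<nu> x g" "\<And>p. p > 0 \<Longrightarrow> (h has_real_derivative - g p) (at p)"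
      using stable_cm_deriv[OF h(1) \<nu> x] by blast
    have "laplace_moment f (Suc n) p = g p" if "p > 0" for p
      using laplace_moment_Suc_eq[OF meas bound that h(2) g(2)[OF that]] by blast
    then show ?case using g(1) by blast
  qed
  show "laplace_moment f n p \<ge> 0" if "p > 0" for n p
    using ex[of n] that stable_cm_nonneg by force
qed

section \<open>Laplace transforms and fractional integrals of Wright functions\<close>

text \<open>
  The function F_b(t) of the introduction, for x > 0. It is defined by its Laplace integral, which
  makes measurability and boundedness immediate; the connection to the Wright series is
  made in wright_time_eq_wright.
\<close>

definition wright_time :: "real \<Rightarrow> real \<Rightarrow> real \<Rightarrow> real \<Rightarrow> real" where
  "wright_time \<nu> b x t = (LINT s:{0<..}|lborel. exp (- (t * s)) * spectral \<nu> b x s)"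

lemma wright_time_measurable [measurable]: "wright_time \<nu> b x \<in> borel_measurable borel"
  unfolding wright_time_def set_lebesgue_integral_def by measurable

lemma wright_time_bounded:
  assumes "0 < \<nu>" "\<nu> < 1 / 2" "b < 1" "x > 0"
  obtains B where "\<And>t. t > 0 \<Longrightarrow> \<bar>wright_time \<nu> b x t\<bar> \<le> B"
proof
  fix t :: real assume t: "t > 0"
  have i: "set_integrable lborel {0<..} (\<lambda>s. \<bar>spectral \<nu> b x s\<bar>)"
    using spectral_integrable[OF assms] by (rule set_integrable_abs)
  have j: "set_integrable lborel {0<..} (\<lambda>s. exp (- (t * s)) * spectral \<nu> b x s)"
    using assms t by (intro wright_series_laplace) auto
  have "\<bar>wright_time \<nu> b x t\<bar> \<le> (LINT s:{0<..}|lborel. \<bar>exp (- (t * s)) * spectral \<nu> b x s\<bar>)"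
    unfolding wright_time_def using set_integral_norm_bound[OF j] by simp
  also have "\<dots> \<le> (LINT s:{0<..}|lborel. \<bar>spectral \<nu> b x s\<bar>)"
  proof (rule set_integral_mono[OF set_integrable_abs[OF j] i])
    fix s :: real assume "s \<in> {0<..}"
    then have "exp (- (t * s)) * \<bar>spectral \<nu> b x s\<bar> \<le> 1 * \<bar>spectral \<nu> b x s\<bar>"
      using t by (intro mult_right_mono) auto
    then show "\<bar>exp (- (t * s)) * spectral \<nu> b x s\<bar> \<le> \<bar>spectral \<nu> b x s\<bar>"
      by (simp add: abs_mult)
  qed
  finally show "\<bar>wright_time \<nu> b x t\<bar> \<le> (LINT s:{0<..}|lborel. \<bar>spectral \<nu> b x s\<bar>)" .
qed

lemma exp_integral:
  fixes r :: real assumes "r > 0"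
  shows "integrable lborel (\<lambda>t. indicator {0<..} t * exp (- (r * t)))"
    and "(\<integral>t. indicator {0<..} t * exp (- (r * t)) \<partial>lborel) = 1 / r"
  using power_exp_integral[OF assms, of 0]
  by (auto simp: set_integrable_def set_lebesgue_integral_def)

lemma laplace_wright_time:
  assumes "0 < \<nu>" "\<nu> < 1 / 2" "b < 1" "x > 0" "p > 0"
  shows "laplace_moment (wright_time \<nu> b x) 0 p = p powr (- b) * exp (- (x * p powr \<nu>))"
proof -
  define g where "g = (\<lambda>s. indicator {0<..} s * spectral \<nu> b x s)"
  define F where "F = (\<lambda>s t::real. g s * (indicator {0<..} t * exp (- ((s + p) * t))))"
  have [measurable]: "g \<in> borel_measurable borel" unfolding g_def by measurable
  have g0: "g s = 0" if "s \<le> 0" for s using that by (simp add: g_def)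
  have inner: "integrable lborel (F s)" "(\<integral>t. F s t \<partial>lborel) = g s / (s + p)"
    "(\<integral>t. norm (F s t) \<partial>lborel) = \<bar>g s\<bar> / (s + p)" for s
  proof -
    show 1: "integrable lborel (F s)"
      using exp_integral(1)[of "s + p"] assms g0[of s] unfolding F_def
      by (cases "s > 0") (auto intro: integrable_mult_right)
    show 2: "(\<integral>t. F s t \<partial>lborel) = g s / (s + p)"
      using exp_integral(2)[of "s + p"] assms g0[of s] unfolding F_def by (cases "s > 0") auto
    have "norm (F s t) = \<bar>g s\<bar> * (indicator {0<..} t * exp (- ((s + p) * t)))" for t
      by (simp add: F_def abs_mult)
    then show "(\<integral>t. norm (F s t) \<partial>lborel) = \<bar>g s\<bar> / (s + p)"
      using exp_integral(2)[of "s + p"] assms g0[of s] by (cases "s > 0") auto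
  qed
  have ig: "integrable lborel (\<lambda>s. \<bar>g s\<bar> / (s + p))"
  proof -
    have "integrable lborel (\<lambda>s. \<bar>indicator {0<..} s *\<^sub>R (spectral \<nu> b x s / (s + p))\<bar>)"
      using spectral_stieltjes(1)[OF assms] unfolding set_integrable_def by (rule integrable_abs)
    also have "(\<lambda>s. \<bar>indicator {0<..} s *\<^sub>R (spectral \<nu> b x s / (s + p))\<bar>) = (\<lambda>s. \<bar>g s\<bar> / (s + p))"
      using assms by (auto simp: g_def fun_eq_iff split: split_indicator)
    finally show ?thesis .
  qed
  have "integrable (lborel \<Otimes>\<^sub>M lborel) (case_prod F)"
  proof (rule lborel_pair.Fubini_integrable)
    show "case_prod F \<in> borel_measurable (lborel \<Otimes>\<^sub>M lborel)"
      unfolding F_def by measurable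
  qed (use inner ig in auto)
  then have "(\<integral>t. (\<integral>s. F s t \<partial>lborel) \<partial>lborel) = (\<integral>s. (\<integral>t. F s t \<partial>lborel) \<partial>lborel)"
    by (rule lborel_pair.Fubini_integral)
  moreover have "(\<integral>s. F s t \<partial>lborel) = indicator {0<..} t *\<^sub>R (t ^ 0 * exp (- (p * t)) * wright_time \<nu> b x t)" for t
  proof -
    have "F s t = (indicator {0<..} t * exp (- (p * t))) *
        (indicator {0<..} s *\<^sub>R (exp (- (t * s)) * spectral \<nu> b x s))" for s
      by (simp add: F_def g_def algebra_simps exp_add[symmetric])
    then show ?thesis by (simp add: wright_time_def set_lebesgue_integral_def)
  qed
  moreover have "(\<integral>s. g s / (s + p) \<partial>lborel) = (LINT s:{0<..}|lborel. spectral \<nu> b x s / (s + p))"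
    by (simp add: g_def set_lebesgue_integral_def)
  ultimately show ?thesis
    using spectral_stieltjes(2)[OF assms] inner
    by (simp add: laplace_moment_def set_lebesgue_integral_def)
qed

text \<open>
  \<Gamma>(\<gamma>) times the Riemann--Liouville fractional integral of order \<gamma>. For \<gamma> = 1 - \<alpha> and f
  a derivative, that fractional integral is the Caputo derivative of order \<alpha>.
\<close>

definition abel_conv :: "real \<Rightarrow> (real \<Rightarrow> real) \<Rightarrow> real \<Rightarrow> real" where
  "abel_conv \<gamma> f t = (LINT \<tau>:{0<..<t}|lborel. (t - \<tau>) powr (\<gamma> - 1) * f \<tau>)"

lemma abel_conv_measurable [measurable]:
  assumes [measurable]: "f \<in> borel_measurable borel"
  shows "abel_conv \<gamma> f \<in> borel_measurable borel"
proof -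
  have "abel_conv \<gamma> f = (\<lambda>t. \<integral>\<tau>. (if 0 < \<tau> \<and> \<tau> < t then (t - \<tau>) powr (\<gamma> - 1) * f \<tau> else 0) \<partial>lborel)"
    unfolding abel_conv_def set_lebesgue_integral_def
    by (intro ext Bochner_Integration.integral_cong) auto
  also have "\<dots> \<in> borel_measurable borel" by measurable
  finally show ?thesis .
qed

lemma abel_kernel_unit_integrable:
  fixes \<gamma> :: real
  assumes "\<gamma> > 0"
  shows "integrable lborel (\<lambda>r. indicator {0<..<1} r * (1 - r) powr (\<gamma> - 1))"
proof -
  have "set_integrable lborel {0<..<1} (\<lambda>t. t powr (1 - 1) * (1 - t) powr (\<gamma> - 1))"
    by (rule set_integrable_subset[OF integrable_Beta]) (use assms in auto)
  also have "?this \<longleftrightarrow> integrable lborel (\<lambda>r. indicator {0<..<1} r * (1 - r) powr (\<gamma> - 1))"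
    unfolding set_integrable_def
    by (intro Bochner_Integration.integrable_cong refl) (auto split: split_indicator)
  finally show ?thesis .
qed

text \<open>
  Rescaling to a fixed interval removes t from the singular kernel, so that bounds and continuity in t
  follow from those of f.
\<close>

lemma abel_conv_scaled:
  assumes "t > 0"
  shows "abel_conv \<gamma> f t = t powr \<gamma> *
    (\<integral>r. indicator {0<..<1} r * ((1 - r) powr (\<gamma> - 1) * f (t * r)) \<partial>lborel)"
    and "set_integrable lborel {0<..<t} (\<lambda>\<tau>. (t - \<tau>) powr (\<gamma> - 1) * f \<tau>) \<longleftrightarrow>
      integrable lborel (\<lambda>r. indicator {0<..<1} r * ((1 - r) powr (\<gamma> - 1) * f (t * r)))"
proof -
  let ?h = "\<lambda>\<tau>. indicator {0<..<t} \<tau> *\<^sub>R ((t - \<tau>) powr (\<gamma> - 1) * f \<tau>)"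
  let ?u = "\<lambda>r. indicator {0<..<1} r * ((1 - r) powr (\<gamma> - 1) * f (t * r))"
  have h: "?h (0 + t * r) = t powr (\<gamma> - 1) * ?u r" for r
  proof (cases "0 < r \<and> r < 1")
    case True
    have "(t - t * r) = t * (1 - r)" by (simp add: algebra_simps)
    then show ?thesis using True assms by (simp add: powr_mult)
  next
    case False
    then show ?thesis using assms by (auto simp: zero_less_mult_iff split: split_indicator)
  qed
  have "abel_conv \<gamma> f t = t * (\<integral>r. ?h (0 + t * r) \<partial>lborel)"
    unfolding abel_conv_def set_lebesgue_integral_def
    using lborel_integral_real_affine[of t ?h 0] assms by simp
  also have "\<dots> = t powr \<gamma> * (\<integral>r. ?u r \<partial>lborel)"
  proof -
    have "t * t powr (\<gamma> - 1) = t powr \<gamma>" using assms by (simp add: powr_mult_base)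
    then show ?thesis unfolding h integral_mult_right_zero by (simp add: mult.assoc[symmetric])
  qed
  finally show "abel_conv \<gamma> f t = t powr \<gamma> * (\<integral>r. ?u r \<partial>lborel)" .
  have "set_integrable lborel {0<..<t} (\<lambda>\<tau>. (t - \<tau>) powr (\<gamma> - 1) * f \<tau>) \<longleftrightarrow>
      integrable lborel (\<lambda>r. ?h (0 + t * r))"
    unfolding set_integrable_def using lborel_integrable_real_affine_iff[of t ?h 0] assms by simp
  also have "\<dots> \<longleftrightarrow> integrable lborel ?u"
    unfolding h using assms by simp
  finally show "set_integrable lborel {0<..<t} (\<lambda>\<tau>. (t - \<tau>) powr (\<gamma> - 1) * f \<tau>) \<longleftrightarrow>
      integrable lborel ?u" .
qed

lemma abel_integrand_bound:
  fixes f :: "real \<Rightarrow> real"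
  assumes "\<And>s. s > 0 \<Longrightarrow> \<bar>f s\<bar> \<le> B" "t > 0"
  shows "\<bar>indicator {0<..<1} r * ((1 - r) powr (\<gamma> - 1) * f (t * r))\<bar>
    \<le> \<bar>B\<bar> * (indicator {0<..<1} r * (1 - r) powr (\<gamma> - 1))"
proof (cases "0 < r \<and> r < 1")
  case True
  then have "\<bar>f (t * r)\<bar> \<le> B" using assms by auto
  then have "(1 - r) powr (\<gamma> - 1) * \<bar>f (t * r)\<bar> \<le> (1 - r) powr (\<gamma> - 1) * \<bar>B\<bar>"
    by (intro mult_left_mono) auto
  then show ?thesis using True by (simp add: abs_mult mult.commute)
qed auto

lemma abel_conv_integrable:
  fixes f :: "real \<Rightarrow> real"
  assumes [measurable]: "f \<in> borel_measurable borel"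
    and "\<And>s. s > 0 \<Longrightarrow> \<bar>f s\<bar> \<le> B" "\<gamma> > 0" "t > 0"
  shows "set_integrable lborel {0<..<t} (\<lambda>\<tau>. (t - \<tau>) powr (\<gamma> - 1) * f \<tau>)"
  unfolding abel_conv_scaled(2)[OF assms(4)]
proof (rule Bochner_Integration.integrable_bound)
  show "integrable lborel (\<lambda>r. \<bar>B\<bar> * (indicator {0<..<1} r * (1 - r) powr (\<gamma> - 1)))"
    by (intro integrable_mult_right abel_kernel_unit_integrable assms)
  show "AE r in lborel. norm (indicator {0<..<1} r * ((1 - r) powr (\<gamma> - 1) * f (t * r))) \<le>
      norm (\<bar>B\<bar> * (indicator {0<..<1} r * (1 - r) powr (\<gamma> - 1)))"
    using abel_integrand_bound[of f B t, OF assms(2,4)] by (intro AE_I2) simp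
qed measurable

lemma abel_conv_bound:
  fixes f :: "real \<Rightarrow> real"
  assumes [measurable]: "f \<in> borel_measurable borel"
    and "\<And>s. s > 0 \<Longrightarrow> \<bar>f s\<bar> \<le> B" "\<gamma> > 0"
  obtains K where "K \<ge> 0" "\<And>t. t > 0 \<Longrightarrow> \<bar>abel_conv \<gamma> f t\<bar> \<le> K * t powr \<gamma>"
proof
  let ?K = "\<integral>r. \<bar>B\<bar> * (indicator {0<..<1} r * (1 - r) powr (\<gamma> - 1)) \<partial>lborel"
  show "?K \<ge> 0" by (intro integral_nonneg_AE) auto
  fix t :: real assume t: "t > 0"
  have "\<bar>\<integral>r. indicator {0<..<1} r * ((1 - r) powr (\<gamma> - 1) * f (t * r)) \<partial>lborel\<bar> \<le> ?K"
    using abel_integrand_bound[of f B t, OF assms(2) t] assms(3)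
    by (intro integral_abs_bound_integral)
      (auto intro!: abel_kernel_unit_integrable abel_conv_integrable[OF assms t, unfolded abel_conv_scaled(2)[OF t]])
  then have "t powr \<gamma> * \<bar>\<integral>r. indicator {0<..<1} r * ((1 - r) powr (\<gamma> - 1) * f (t * r)) \<partial>lborel\<bar>
      \<le> t powr \<gamma> * ?K"
    by (intro mult_left_mono) auto
  then show "\<bar>abel_conv \<gamma> f t\<bar> \<le> ?K * t powr \<gamma>"
    unfolding abel_conv_scaled(1)[OF t] by (simp add: abs_mult mult.commute)
qed

lemma abel_conv_isCont:
  fixes f :: "real \<Rightarrow> real"
  assumes [measurable]: "f \<in> borel_measurable borel"
    and "\<And>s. s > 0 \<Longrightarrow> \<bar>f s\<bar> \<le> B" "\<gamma> > 0"
    and cont: "\<And>s. s > 0 \<Longrightarrow> isCont f s" and t: "t > 0"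
  shows "isCont (abel_conv \<gamma> f) t"
proof -
  let ?u = "\<lambda>t r. indicator {0<..<1} r * ((1 - r) powr (\<gamma> - 1) * f (t * r))"
  have "continuous (at t within {0<..}) (\<lambda>t. t powr \<gamma> * (\<integral>r. ?u t r \<partial>lborel))"
  proof (intro continuous_intros)
    show "continuous (at t within {0<..}) (\<lambda>t. \<integral>r. ?u t r \<partial>lborel)"
      unfolding continuous_within_sequentially o_def
    proof (intro allI impI, elim conjE)
      fix X :: "nat \<Rightarrow> real"
      assume X: "\<forall>n. X n \<in> {0<..}" and lim: "X \<longlonglongrightarrow> t"
      show "(\<lambda>n. \<integral>r. ?u (X n) r \<partial>lborel) \<longlonglongrightarrow> (\<integral>r. ?u t r \<partial>lborel)"
      proof (rule integral_dominated_convergence)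
        show "integrable lborel (\<lambda>r. \<bar>B\<bar> * (indicator {0<..<1} r * (1 - r) powr (\<gamma> - 1)))"
          by (intro integrable_mult_right abel_kernel_unit_integrable assms)
        show "AE r in lborel. norm (?u (X n) r) \<le> \<bar>B\<bar> * (indicator {0<..<1} r * (1 - r) powr (\<gamma> - 1))" for n
          using abel_integrand_bound[of f B "X n", OF assms(2)] X by (intro AE_I2) simp
        show "AE r in lborel. (\<lambda>n. ?u (X n) r) \<longlonglongrightarrow> ?u t r"
        proof (intro AE_I2)
          fix r :: real
          show "(\<lambda>n. ?u (X n) r) \<longlonglongrightarrow> ?u t r"
          proof (cases "0 < r")
            case True
            have "(\<lambda>n. X n * r) \<longlonglongrightarrow> t * r" by (intro tendsto_intros lim)
            then have "(\<lambda>n. f (X n * r)) \<longlonglongrightarrow> f (t * r)"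
              using cont[of "t * r"] True t by (intro isCont_tendsto_compose[where g = f]) auto
            then show ?thesis by (intro tendsto_intros)
          qed auto
        qed
      qed measurable
    qed
  qed (use t in auto)
  moreover have "at t within {0<..} = at t" by (rule at_within_open) (use t in auto)
  ultimately have "isCont (\<lambda>t. t powr \<gamma> * (\<integral>r. ?u t r \<partial>lborel)) t" by simp
  moreover have "\<forall>\<^sub>F s in nhds t. abel_conv \<gamma> f s = s powr \<gamma> * (\<integral>r. ?u s r \<partial>lborel)"
    using eventually_nhds_in_open[of "{0<..}" t] t
    by (auto elim!: eventually_mono intro: abel_conv_scaled(1))
  ultimately show ?thesis by (subst isCont_cong)
qed

lemma laplace_abel_conv:
  fixes f :: "real \<Rightarrow> real"
  assumes [measurable]: "f \<in> borel_measurable borel"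
    and bound: "\<And>s. s > 0 \<Longrightarrow> \<bar>f s\<bar> \<le> B" and "\<gamma> > 0" "p > 0"
  shows "set_integrable lborel {0<..} (\<lambda>t. exp (- (p * t)) * abel_conv \<gamma> f t)"
    and "laplace_moment (abel_conv \<gamma> f) 0 p = Gamma \<gamma> / p powr \<gamma> * laplace_moment f 0 p"
proof -
  define k where "k = (\<lambda>v::real. indicator {0<..} v * (v powr (\<gamma> - 1) * exp (- (p * v))))"
  define g where "g = (\<lambda>\<tau>::real. indicator {0<..} \<tau> * (exp (- (p * \<tau>)) * f \<tau>))"
  define F where "F = (\<lambda>\<tau> t::real. g \<tau> * k (t - \<tau>))"
  have [measurable]: "k \<in> borel_measurable borel" unfolding k_def by measurable
  have [measurable]: "g \<in> borel_measurable borel" unfolding g_def by measurable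
  have k: "integrable lborel k" "(\<integral>v. k v \<partial>lborel) = Gamma \<gamma> / p powr \<gamma>"
    using gamma_laplace[of \<gamma> p] assms
    by (auto simp: k_def[abs_def] set_integrable_def set_lebesgue_integral_def)
  have ksh: "integrable lborel (\<lambda>t. k (t - \<tau>))" "(\<integral>t. k (t - \<tau>) \<partial>lborel) = Gamma \<gamma> / p powr \<gamma>" for \<tau>
    using lborel_integrable_real_affine[OF k(1), of 1 "- \<tau>"] lborel_integral_real_affine[of 1 k "- \<tau>"] k(2)
    by (simp_all add: algebra_simps)
  have k0: "k v \<ge> 0" for v by (simp add: k_def)
  have ig: "integrable lborel g"
    using laplace_moment_integrable[OF assms(1) bound \<open>p > 0\<close>, of 0]
    by (simp add: g_def[abs_def] set_integrable_def)
  have "(\<integral>t. norm (F \<tau> t) \<partial>lborel) = \<bar>g \<tau>\<bar> * (Gamma \<gamma> / p powr \<gamma>)" for \<tau>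
    using k0 ksh[of \<tau>] by (simp add: F_def abs_mult)
  then have int: "integrable (lborel \<Otimes>\<^sub>M lborel) (case_prod F)"
  proof (intro lborel_pair.Fubini_integrable)
    show "case_prod F \<in> borel_measurable (lborel \<Otimes>\<^sub>M lborel)" unfolding F_def by measurable
  qed (use ksh ig in \<open>auto simp: F_def\<close>)
  have F: "(\<integral>\<tau>. F \<tau> t \<partial>lborel) = indicator {0<..} t *\<^sub>R (exp (- (p * t)) * abel_conv \<gamma> f t)" for t
  proof -
    have "F \<tau> t = indicator {0<..} t * exp (- (p * t)) *
       (indicator {0<..<t} \<tau> *\<^sub>R ((t - \<tau>) powr (\<gamma> - 1) * f \<tau>))" for \<tau>
      by (auto simp: F_def g_def k_def algebra_simps exp_add[symmetric] split: split_indicator)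
    then show ?thesis by (simp add: abel_conv_def set_lebesgue_integral_def)
  qed
  show "set_integrable lborel {0<..} (\<lambda>t. exp (- (p * t)) * abel_conv \<gamma> f t)"
    using lborel_pair.integrable_snd[OF int] unfolding F set_integrable_def .
  have "(\<integral>t. (\<integral>\<tau>. F \<tau> t \<partial>lborel) \<partial>lborel) = (\<integral>\<tau>. (\<integral>t. F \<tau> t \<partial>lborel) \<partial>lborel)"
    using int by (rule lborel_pair.Fubini_integral)
  also have "\<dots> = (\<integral>\<tau>. g \<tau> \<partial>lborel) * (Gamma \<gamma> / p powr \<gamma>)"
    by (simp add: F_def ksh)
  finally show "laplace_moment (abel_conv \<gamma> f) 0 p = Gamma \<gamma> / p powr \<gamma> * laplace_moment f 0 p"
    unfolding F by (simp add: laplace_moment_def set_lebesgue_integral_def g_def mult.commute)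
qed

lemma laplace_moment_0_tilt: "laplace_moment (\<lambda>t. exp (- t) * f t) 0 p = laplace_moment f 0 (p + 1)"
  unfolding laplace_moment_def set_lebesgue_integral_def
  by (intro Bochner_Integration.integral_cong refl) (simp add: algebra_simps exp_add[symmetric])

text \<open>
  Both sides have the Laplace transform \<Gamma>(\<gamma>) p^(-\<gamma>) exp(-x p^\<nu>).
\<close>

lemma abel_conv_wright_time:
  assumes \<nu>: "0 < \<nu>" "\<nu> < 1 / 2" and x: "x > 0" and \<gamma>: "0 < \<gamma>" "\<gamma> < 1" and t: "t > 0"
    and cont0: "\<And>s. s > 0 \<Longrightarrow> isCont (wright_time \<nu> 0 x) s"
    and cont: "isCont (wright_time \<nu> \<gamma> x) t"
  shows "abel_conv \<gamma> (wright_time \<nu> 0 x) t = Gamma \<gamma> * wright_time \<nu> \<gamma> x t"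
proof -
  let ?c = "abel_conv \<gamma> (wright_time \<nu> 0 x)"
  define D where "D = (\<lambda>t. ?c t - Gamma \<gamma> * wright_time \<nu> \<gamma> x t)"
  obtain B0 where B0: "\<And>t. t > 0 \<Longrightarrow> \<bar>wright_time \<nu> 0 x t\<bar> \<le> B0"
    using wright_time_bounded[OF \<nu> _ x, of 0] by auto
  obtain B1 where B1: "\<And>t. t > 0 \<Longrightarrow> \<bar>wright_time \<nu> \<gamma> x t\<bar> \<le> B1"
    using wright_time_bounded[OF \<nu> \<gamma>(2) x] by auto
  obtain K where K: "K \<ge> 0" "\<And>t. t > 0 \<Longrightarrow> \<bar>?c t\<bar> \<le> K * t powr \<gamma>"
    using abel_conv_bound[OF wright_time_measurable B0 \<gamma>(1)] by blast
  \<comment> \<open>The uniqueness criterion is for bounded functions, while the convolution is only known to be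
    O(t^\<gamma>). The factor exp(-t) restores boundedness and only shifts the transform.\<close>
  have "exp (- t) * D t = 0"
  proof (rule laplace_unique_at[where f = "\<lambda>t. exp (- t) * D t" and B = "K + \<bar>Gamma \<gamma>\<bar> * B1", OF _ _ t])
    show "(\<lambda>t. exp (- t) * D t) \<in> borel_measurable borel"
      unfolding D_def by measurable
    show "isCont (\<lambda>t. exp (- t) * D t) t"
      unfolding D_def
      by (intro continuous_intros abel_conv_isCont[OF wright_time_measurable B0 \<gamma>(1) cont0 t] cont)
    fix s :: real assume s: "s > 0"
    have "s powr \<gamma> \<le> exp s"
    proof -
      have "s powr \<gamma> \<le> (1 + s) powr 1"
        using s \<gamma> by (intro order_trans[OF powr_mono2 powr_mono]) auto
      also have "\<dots> \<le> exp s" using s by simp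
      finally show ?thesis .
    qed
    then have "K * s powr \<gamma> \<le> K * exp s" using K by (intro mult_left_mono) auto
    moreover have "\<bar>Gamma \<gamma>\<bar> * \<bar>wright_time \<nu> \<gamma> x s\<bar> \<le> \<bar>Gamma \<gamma>\<bar> * B1 * exp s"
    proof -
      have "\<bar>wright_time \<nu> \<gamma> x s\<bar> \<le> B1 * exp s"
        using B1[OF s] s mult_left_mono[of 1 "exp s" B1] by fastforce
      then show ?thesis by (simp add: mult_left_mono mult.assoc)
    qed
    ultimately have "\<bar>D s\<bar> \<le> (K + \<bar>Gamma \<gamma>\<bar> * B1) * exp s"
      using K(2)[OF s] abs_triangle_ineq4[of "?c s" "Gamma \<gamma> * wright_time \<nu> \<gamma> x s"]
      unfolding D_def abs_mult distrib_right by linarith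
    then show "\<bar>exp (- s) * D s\<bar> \<le> K + \<bar>Gamma \<gamma>\<bar> * B1"
      by (simp add: abs_mult exp_minus field_simps)
  next
    fix p :: real assume "p > 0"
    then have q: "p + 1 > 0" by simp
    have "laplace_moment D 0 (p + 1) =
      laplace_moment ?c 0 (p + 1) - Gamma \<gamma> * laplace_moment (wright_time \<nu> \<gamma> x) 0 (p + 1)"
    proof -
      have i1: "set_integrable lborel {0<..} (\<lambda>s. s ^ 0 * exp (- ((p + 1) * s)) * ?c s)"
        using laplace_abel_conv(1)[OF wright_time_measurable B0 \<gamma>(1) q] by simp
      have i2: "set_integrable lborel {0<..} (\<lambda>s. Gamma \<gamma> * (s ^ 0 * exp (- ((p + 1) * s)) * wright_time \<nu> \<gamma> x s))"
        using laplace_moment_integrable[OF wright_time_measurable B1 q, of 0] by (rule set_integrable_mult_right)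
      have "laplace_moment D 0 (p + 1) =
        (LINT s:{0<..}|lborel. s ^ 0 * exp (- ((p + 1) * s)) * ?c s
           - Gamma \<gamma> * (s ^ 0 * exp (- ((p + 1) * s)) * wright_time \<nu> \<gamma> x s))"
        by (simp add: laplace_moment_def D_def algebra_simps)
      also have "\<dots> = laplace_moment ?c 0 (p + 1) - Gamma \<gamma> * laplace_moment (wright_time \<nu> \<gamma> x) 0 (p + 1)"
        unfolding set_integral_diff(2)[OF i1 i2] by (simp add: laplace_moment_def)
      finally show ?thesis .
    qed
    also have "\<dots> = 0"
      using laplace_abel_conv(2)[OF wright_time_measurable B0 \<gamma>(1) q]
        laplace_wright_time[OF \<nu> _ x q, of 0] laplace_wright_time[OF \<nu> \<gamma>(2) x q] q
      by (simp add: powr_minus divide_inverse)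
    finally show "laplace_moment (\<lambda>t. exp (- t) * D t) 0 p = 0"
      by (simp add: laplace_moment_0_tilt)
  qed
  then show ?thesis by (simp add: D_def)
qed

lemma wright_time_nonneg:
  assumes "0 < \<nu>" "\<nu> < 1 / 2" "0 \<le> b" "b < 1" "x > 0" "t > 0" "isCont (wright_time \<nu> b x) t"
  shows "wright_time \<nu> b x t \<ge> 0"
proof -
  obtain B where "\<And>t. t > 0 \<Longrightarrow> \<bar>wright_time \<nu> b x t\<bar> \<le> B"
    using wright_time_bounded[of \<nu> b x] assms by auto
  then show ?thesis
    using assms by (intro nonneg_if_laplace_stable[OF wright_time_measurable, where x = x and b = b and \<nu> = \<nu>]
      laplace_wright_time) auto
qed

section \<open>The Mainardi function and the equation for the free boundary\<close>

definition wright_coeff :: "real \<Rightarrow> real \<Rightarrow> nat \<Rightarrow> real" where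
  "wright_coeff \<nu> b n = rGamma (b - \<nu> * n) / fact n"

lemma wright_powser: "wright z (- \<nu>) b = (\<Sum>n. wright_coeff \<nu> b n * z ^ n)"
  by (simp add: wright_def wright_coeff_def algebra_simps)

lemma diffs_wright_coeff: "diffs (wright_coeff \<nu> b) = wright_coeff \<nu> (b - \<nu>)"
proof
  fix n :: nat
  have eq: "b - \<nu> * real (Suc n) = b - \<nu> - \<nu> * n" by (simp add: algebra_simps)
  show "diffs (wright_coeff \<nu> b) n = wright_coeff \<nu> (b - \<nu>) n"
    unfolding diffs_def wright_coeff_def eq by (simp del: of_nat_Suc)
qed

lemma wright_summable_aux:
  fixes z :: real
  assumes "0 < \<nu>" "\<nu> < 1" "b < 1"
  shows "summable (\<lambda>n. wright_coeff \<nu> b n * z ^ n)"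
  using sums_summable[OF wright_series_laplace(2)[of \<nu> b 1 "- z"]] assms
  by (simp add: wright_coeff_def mult_ac)

text \<open>
  The series with parameter b - \<nu> is the derived series of the one with parameter b, so
  convergence passes up from b - \<nu> < 1. This reaches b = 1, the parameter of the temperature profile.
\<close>

lemma wright_summable:
  fixes z :: real
  assumes "0 < \<nu>" "\<nu> < 1" "b < 1 + \<nu>"
  shows "summable (\<lambda>n. wright_coeff \<nu> b n * z ^ n)"
proof -
  have "summable (\<lambda>n. wright_coeff \<nu> (b - \<nu>) n * (\<bar>z\<bar> + 1) ^ n)"
    using assms by (intro wright_summable_aux) auto
  then have "summable (\<lambda>n. norm (wright_coeff \<nu> (b - \<nu>) n * z ^ n))"
    by (rule powser_insidea) auto
  then have "summable (\<lambda>n. \<bar>z\<bar> * norm (wright_coeff \<nu> (b - \<nu>) n * z ^ n))"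
    by (rule summable_mult)
  then have "summable (\<lambda>n. wright_coeff \<nu> b (Suc n) * z ^ Suc n)"
  proof (rule summable_comparison_test'[where N = 0])
    fix n :: nat
    have "\<bar>wright_coeff \<nu> b (Suc n)\<bar> * 1 \<le> \<bar>wright_coeff \<nu> b (Suc n)\<bar> * (1 + real n)"
      by (intro mult_left_mono) auto
    also have "\<dots> = \<bar>diffs (wright_coeff \<nu> b) n\<bar>"
      by (simp add: diffs_def abs_mult mult.commute)
    finally have "\<bar>wright_coeff \<nu> b (Suc n)\<bar> \<le> \<bar>wright_coeff \<nu> (b - \<nu>) n\<bar>"
      by (simp add: diffs_wright_coeff)
    then have "(\<bar>z\<bar> * \<bar>z\<bar> ^ n) * \<bar>wright_coeff \<nu> b (Suc n)\<bar> \<le> (\<bar>z\<bar> * \<bar>z\<bar> ^ n) * \<bar>wright_coeff \<nu> (b - \<nu>) n\<bar>"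
      by (intro mult_left_mono) auto
    then show "norm (wright_coeff \<nu> b (Suc n) * z ^ Suc n) \<le> \<bar>z\<bar> * norm (wright_coeff \<nu> (b - \<nu>) n * z ^ n)"
      by (simp add: abs_mult power_abs mult_ac)
  qed
  then show ?thesis by (rule summable_Suc_iff[THEN iffD1])
qed

lemma wright_has_derivative:
  assumes "0 < \<nu>" "\<nu> < 1" "b < 1 + \<nu>"
  shows "((\<lambda>z. wright z (- \<nu>) b) has_real_derivative wright z (- \<nu>) (b - \<nu>)) (at z)"
  unfolding wright_powser diffs_wright_coeff[symmetric]
  by (rule termdiffs_strong_converges_everywhere) (rule wright_summable[OF assms])

lemma wright_continuous_on:
  assumes "0 < \<nu>" "\<nu> < 1" "b < 1 + \<nu>"
  shows "continuous_on S (\<lambda>z. wright z (- \<nu>) b)"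
  using wright_has_derivative[OF assms]
  by (intro continuous_at_imp_continuous_on ballI DERIV_isCont) auto

lemma wright_0: "wright 0 a b = rGamma b"
proof -
  have "wright 0 a b = (\<Sum>n. (rGamma (a * real n + b) / fact n) * 0 ^ n)"
    by (simp add: wright_def mult_ac)
  then show ?thesis by (simp only: powser_zero) simp
qed

lemma wright_time_eq_wright:
  assumes "0 < \<nu>" "\<nu> < 1" "b < 1" "t > 0"
  shows "wright_time \<nu> b x t = t powr (b - 1) * wright (- (x / t powr \<nu>)) (- \<nu>) b"
proof -
  have "(\<lambda>n. wright_coeff \<nu> b n * (- (x / t powr \<nu>)) ^ n) sums wright (- (x / t powr \<nu>)) (- \<nu>) b"
    unfolding wright_powser using assms by (intro summable_sums wright_summable) auto
  then have "(\<lambda>n. t powr (b - 1) * (wright_coeff \<nu> b n * (- (x / t powr \<nu>)) ^ n)) sums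
      (t powr (b - 1) * wright (- (x / t powr \<nu>)) (- \<nu>) b)"
    by (rule sums_mult)
  moreover have "t powr (b - 1) * (wright_coeff \<nu> b n * (- (x / t powr \<nu>)) ^ n) =
    (- x) ^ n / fact n * rGamma (b - \<nu> * n) * t powr (b - \<nu> * n - 1)" for n
  proof -
    have "(- (x / t powr \<nu>)) ^ n = (- x) ^ n / t powr (\<nu> * n)"
      unfolding minus_divide_left power_divide using assms by (simp add: powr_power mult.commute)
    moreover have "t powr (b - \<nu> * n - 1) = t powr (b - 1) / t powr (\<nu> * n)"
      by (simp add: powr_diff[symmetric] algebra_simps)
    ultimately show ?thesis by (simp add: wright_coeff_def)
  qed
  ultimately have s: "(\<lambda>n. (- x) ^ n / fact n * rGamma (b - \<nu> * n) * t powr (b - \<nu> * n - 1)) sums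
      (t powr (b - 1) * wright (- (x / t powr \<nu>)) (- \<nu>) b)"
    by (simp only:)
  show ?thesis
    unfolding wright_time_def by (rule sums_unique2[OF wright_series_laplace(2)[OF assms] s])
qed

lemma wright_time_isCont:
  assumes "0 < \<nu>" "\<nu> < 1" "b < 1" "t > 0"
  shows "isCont (wright_time \<nu> b x) t"
proof -
  have "isCont (\<lambda>z. wright z (- \<nu>) b) z" for z
    using wright_has_derivative[of \<nu> b] assms by (intro DERIV_isCont) auto
  moreover have "isCont (\<lambda>t. - (x / t powr \<nu>)) t"
    using assms by (intro continuous_intros) auto
  ultimately have "isCont (\<lambda>t. wright (- (x / t powr \<nu>)) (- \<nu>) b) t"
    using isCont_o2[of t "\<lambda>t. - (x / t powr \<nu>)" "\<lambda>z. wright z (- \<nu>) b"] by blast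
  then have "isCont (\<lambda>t. t powr (b - 1) * wright (- (x / t powr \<nu>)) (- \<nu>) b) t"
    using assms by (intro isCont_mult) (auto intro!: continuous_intros)
  moreover have "\<forall>\<^sub>F s in nhds t. wright_time \<nu> b x s = s powr (b - 1) * wright (- (x / s powr \<nu>)) (- \<nu>) b"
    using eventually_nhds_in_open[of "{0<..}" t] assms
    by (auto elim!: eventually_mono intro: wright_time_eq_wright)
  ultimately show ?thesis by (subst isCont_cong)
qed

lemma wright_nonneg:
  assumes "0 < \<nu>" "\<nu> < 1 / 2" "0 \<le> b" "b < 1" "z > 0"
  shows "wright (- z) (- \<nu>) b \<ge> 0"
  using wright_time_nonneg[of \<nu> b z 1] wright_time_isCont[of \<nu> b 1 z]
    wright_time_eq_wright[of \<nu> b 1 z] assms by simp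

lemma abel_conv_wright:
  assumes "0 < \<nu>" "\<nu> < 1 / 2" "x > 0" "0 < \<gamma>" "\<gamma> < 1" "t > 0"
  shows "abel_conv \<gamma> (wright_time \<nu> 0 x) t =
    Gamma \<gamma> * (t powr (\<gamma> - 1) * wright (- (x / t powr \<nu>)) (- \<nu>) \<gamma>)"
  using abel_conv_wright_time[of \<nu> x \<gamma> t] wright_time_isCont assms
  by (simp add: wright_time_eq_wright)

lemma wright_0_eq_mainardi:
  assumes "0 < \<nu>" "\<nu> < 1"
  shows "wright (- z) (- \<nu>) 0 = \<nu> * z * mainardi \<nu> z"
proof -
  have "(\<lambda>n. wright_coeff \<nu> (1 - \<nu>) n * (- z) ^ n) sums mainardi \<nu> z"
    unfolding mainardi_def wright_powser using assms by (intro summable_sums wright_summable) auto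
  then have "(\<lambda>n. \<nu> * z * (wright_coeff \<nu> (1 - \<nu>) n * (- z) ^ n)) sums (\<nu> * z * mainardi \<nu> z)"
    by (rule sums_mult)
  also have "(\<lambda>n. \<nu> * z * (wright_coeff \<nu> (1 - \<nu>) n * (- z) ^ n)) =
      (\<lambda>n. wright_coeff \<nu> 0 (Suc n) * (- z) ^ Suc n)"
  proof
    fix n :: nat
    have "rGamma (0 - \<nu> * Suc n) = - (\<nu> * Suc n) * rGamma (1 - \<nu> - \<nu> * n)"
      using rGamma_plus1[of "- (\<nu> * Suc n)"] by (simp add: algebra_simps)
    then have "wright_coeff \<nu> 0 (Suc n) = - \<nu> * wright_coeff \<nu> (1 - \<nu>) n"
      unfolding wright_coeff_def by (simp add: field_simps del: of_nat_Suc)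
    then show "\<nu> * z * (wright_coeff \<nu> (1 - \<nu>) n * (- z) ^ n) = wright_coeff \<nu> 0 (Suc n) * (- z) ^ Suc n"
      by simp
  qed
  finally have "(\<lambda>n. wright_coeff \<nu> 0 n * (- z) ^ n) sums (\<nu> * z * mainardi \<nu> z + wright_coeff \<nu> 0 0 * (- z) ^ 0)"
    by (rule sums_Suc_iff[THEN iffD1])
  then show ?thesis
    unfolding wright_powser by (simp add: sums_iff wright_coeff_def)
qed

lemma mainardi_has_derivative:
  assumes "0 < \<nu>" "\<nu> < 1"
  shows "(mainardi \<nu> has_real_derivative - wright (- z) (- \<nu>) (1 - 2 * \<nu>)) (at z)"
proof -
  have "((\<lambda>z. wright (- z) (- \<nu>) (1 - \<nu>)) has_real_derivative wright (- z) (- \<nu>) (1 - \<nu> - \<nu>) * (- 1)) (at z)"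
    by (rule DERIV_chain'[where f = uminus, OF _ wright_has_derivative])
      (use assms in \<open>auto intro!: derivative_eq_intros\<close>)
  then show ?thesis by (simp add: mainardi_def[abs_def] algebra_simps)
qed

lemma mainardi_continuous_on:
  assumes "0 < \<nu>" "\<nu> < 1"
  shows "continuous_on S (mainardi \<nu>)"
  by (intro continuous_at_imp_continuous_on ballI DERIV_isCont[OF mainardi_has_derivative[OF assms]])

lemma wright_1_has_derivative:
  assumes "0 < \<nu>" "\<nu> < 1"
  shows "((\<lambda>z. wright (- z) (- \<nu>) 1) has_real_derivative - mainardi \<nu> z) (at z)"
proof -
  have "((\<lambda>z. wright (- z) (- \<nu>) 1) has_real_derivative wright (- z) (- \<nu>) (1 - \<nu>) * (- 1)) (at z)"
    by (rule DERIV_chain'[where f = uminus, OF _ wright_has_derivative])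
      (use assms in \<open>auto intro!: derivative_eq_intros\<close>)
  then show ?thesis by (simp add: mainardi_def)
qed

lemma mainardi_antimono:
  assumes "0 < \<nu>" "\<nu> < 1 / 2" "0 \<le> z" "z \<le> w"
  shows "mainardi \<nu> w \<le> mainardi \<nu> z"
proof (rule DERIV_nonpos_imp_decreasing_open[OF assms(4)])
  show "\<exists>y. (mainardi \<nu> has_real_derivative y) (at x) \<and> y \<le> 0" if "z < x" "x < w" for x
    using mainardi_has_derivative[of \<nu> x] wright_nonneg[of \<nu> "1 - 2 * \<nu>" x] assms that
    by (intro exI[of _ "- wright (- x) (- \<nu>) (1 - 2 * \<nu>)"]) auto
  show "continuous_on {z..w} (mainardi \<nu>)"
    using assms by (intro mainardi_continuous_on) auto
qed

lemma mainardi_0: "mainardi \<nu> 0 = rGamma (1 - \<nu>)"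
  by (simp add: mainardi_def wright_0)

text \<open>
  If the nonincreasing function M vanished somewhere, it would vanish from there on, and then
  F(t) = t^(-\<nu>) M(t^(-\<nu>)) would vanish for all small t. A function vanishing on (0, t0] has a Laplace
  transform of order exp(-p t0), whereas the transform of F is p^(\<nu>-1) exp(-p^\<nu>) with \<nu> < 1.
\<close>

lemma mainardi_pos:
  assumes \<nu>: "0 < \<nu>" "\<nu> < 1 / 2" and z: "z \<ge> 0"
  shows "mainardi \<nu> z > 0"
proof (rule ccontr)
  assume n: "\<not> mainardi \<nu> z > 0"
  \<comment> \<open>The shift makes Z positive, so that Z^(-1/\<nu>) is a positive time.\<close>
  define Z where "Z = z + 1"
  have Z: "Z > 0" using z by (simp add: Z_def)
  have zero: "mainardi \<nu> w = 0" if "w \<ge> Z" for w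
    using mainardi_antimono[OF \<nu> z, of w] wright_nonneg[OF \<nu>, of "1 - \<nu>" w] that n z \<nu>
    by (force simp: mainardi_def Z_def)
  define F where "F = wright_time \<nu> (1 - \<nu>) 1"
  define t0 where "t0 = Z powr (- (1 / \<nu>))"
  have t0: "t0 > 0" using Z by (simp add: t0_def)
  have F: "F t = t powr (- \<nu>) * mainardi \<nu> (1 / t powr \<nu>)" if "t > 0" for t
    using wright_time_eq_wright[of \<nu> "1 - \<nu>" t 1] that \<nu> by (simp add: F_def mainardi_def)
  have F0: "F t \<ge> 0" if "t > 0" for t
    unfolding F_def using \<nu> that by (intro wright_time_nonneg wright_time_isCont) auto
  have Fz: "F t = 0" if "t > 0" "t \<le> t0" for t
  proof -
    have "t powr \<nu> \<le> t0 powr \<nu>" using that \<nu> by (intro powr_mono2) auto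
    also have "t0 powr \<nu> = 1 / Z" unfolding t0_def powr_powr using Z \<nu> by (simp add: powr_minus_divide)
    finally have "1 / t powr \<nu> \<ge> Z" using that Z by (simp add: field_simps)
    from zero[OF this] show ?thesis using F[OF that(1)] by simp
  qed
  obtain B where B: "\<And>t. t > 0 \<Longrightarrow> \<bar>F t\<bar> \<le> B"
    using wright_time_bounded[of \<nu> "1 - \<nu>" 1] \<nu> unfolding F_def by auto
  have meas: "F \<in> borel_measurable borel" unfolding F_def by (rule wright_time_measurable)
  have lap: "laplace_moment F 0 p = p powr (- (1 - \<nu>)) * exp (- (p powr \<nu>))" if "p > 0" for p
    unfolding F_def using laplace_wright_time[of \<nu> "1 - \<nu>" 1 p] that \<nu> by simp
  have le: "p powr (- (1 - \<nu>)) * exp (- (p powr \<nu>)) * exp ((p - 1) * t0) \<le> 1" if p: "p \<ge> 1" for p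
  proof -
    have "laplace_moment F 0 p \<le> exp (- ((p - 1) * t0)) * laplace_moment F 0 1"
      unfolding laplace_moment_def set_integral_mult_right[symmetric]
    proof (rule set_integral_mono)
      show "set_integrable lborel {0<..} (\<lambda>s. s ^ 0 * exp (- (p * s)) * F s)"
        "set_integrable lborel {0<..} (\<lambda>s. exp (- ((p - 1) * t0)) * (s ^ 0 * exp (- (1 * s)) * F s))"
        using p by (intro set_integrable_mult_right laplace_moment_integrable[OF meas B]; simp)+
      fix s :: real assume "s \<in> {0<..}"
      then have s: "s > 0" by simp
      show "s ^ 0 * exp (- (p * s)) * F s \<le> exp (- ((p - 1) * t0)) * (s ^ 0 * exp (- (1 * s)) * F s)"
      proof (cases "s \<le> t0")
        case True
        then show ?thesis using Fz[OF s] by simp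
      next
        case False
        then have "(p - 1) * t0 \<le> (p - 1) * s" using p by (intro mult_left_mono) auto
        then have "exp (- (p * s)) \<le> exp (- ((p - 1) * t0)) * exp (- s)"
          unfolding exp_add[symmetric] by (simp add: algebra_simps)
        from mult_right_mono[OF this F0[OF s]] show ?thesis by (simp add: mult_ac)
      qed
    qed
    also have "\<dots> \<le> exp (- ((p - 1) * t0)) * 1"
      using lap[of 1] by (intro mult_left_mono) auto
    finally have "p powr (- (1 - \<nu>)) * exp (- (p powr \<nu>)) \<le> exp (- ((p - 1) * t0))"
      using lap p by simp
    then have "p powr (- (1 - \<nu>)) * exp (- (p powr \<nu>)) * exp ((p - 1) * t0)
        \<le> exp (- ((p - 1) * t0)) * exp ((p - 1) * t0)"
      by (intro mult_right_mono) auto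
    then show ?thesis by (simp add: exp_add[symmetric])
  qed
  have "filterlim (\<lambda>p. p powr (- (1 - \<nu>)) * exp (- (p powr \<nu>)) * exp ((p - 1) * t0)) at_top at_top"
    using \<nu> t0 by real_asymp
  then have "\<forall>\<^sub>F p in at_top. p powr (- (1 - \<nu>)) * exp (- (p powr \<nu>)) * exp ((p - 1) * t0) > 1"
    by (simp add: filterlim_at_top_dense)
  then obtain p where "p \<ge> 1" "p powr (- (1 - \<nu>)) * exp (- (p powr \<nu>)) * exp ((p - 1) * t0) > 1"
    using eventually_happens'[OF _ eventually_conj[OF _ eventually_ge_at_top[of 1]]] by fastforce
  with le[of p] show False by simp
qed

lemma wright_1_antimono:
  assumes \<nu>: "0 < \<nu>" "\<nu> < 1 / 2" and "0 \<le> z" "z \<le> w"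
  shows "wright (- w) (- \<nu>) 1 \<le> wright (- z) (- \<nu>) 1"
proof (rule DERIV_nonpos_imp_nonincreasing[OF assms(4)])
  show "\<exists>y. ((\<lambda>z. wright (- z) (- \<nu>) 1) has_real_derivative y) (at x) \<and> y \<le> 0" if "z \<le> x" for x
    using wright_1_has_derivative[OF \<nu>(1), of x] mainardi_pos[OF \<nu>, of x] that assms \<nu>
    by (intro exI[of _ "- mainardi \<nu> x"]) auto
qed

lemma stefan_J_root:
  assumes \<nu>: "0 < \<nu>" "\<nu> < 1 / 2" and R: "R > 0"
  shows "\<exists>!\<mu>. 0 < \<mu> \<and> \<mu> / mainardi \<nu> \<mu> = R"
proof -
  let ?J = "\<lambda>\<mu>. \<mu> / mainardi \<nu> \<mu>"
  have mono: "?J a < ?J b" if "0 < a" "a < b" for a b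
    using that mainardi_antimono[OF \<nu>, of a b] mainardi_pos[OF \<nu>, of a] mainardi_pos[OF \<nu>, of b]
    by (intro frac_less) auto
  have uniq: "a = b" if "0 < a" "0 < b" "?J a = ?J b" for a b
    using mono[of a b] mono[of b a] that by (cases a b rule: linorder_cases) auto
  \<comment> \<open>As M is at most M(0), J has reached R at b, so the root lies in [0, b].\<close>
  define b where "b = R * mainardi \<nu> 0"
  have b: "b > 0" using R mainardi_pos[OF \<nu>, of 0] by (simp add: b_def)
  have cont: "continuous_on {0..b} ?J"
  proof (intro continuous_intros ballI)
    show "continuous_on {0..b} (mainardi \<nu>)"
      using \<nu> by (intro mainardi_continuous_on) auto
    show "mainardi \<nu> x \<noteq> 0" if "x \<in> {0..b}" for x
      using mainardi_pos[OF \<nu>, of x] that by auto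
  qed
  have "R = b / mainardi \<nu> 0" using mainardi_pos[OF \<nu>, of 0] by (simp add: b_def)
  also have "\<dots> \<le> ?J b"
    using b mainardi_antimono[OF \<nu>, of 0 b] mainardi_pos[OF \<nu>, of b]
    by (intro divide_left_mono mult_pos_pos mainardi_pos[OF \<nu>]) auto
  finally obtain \<mu> where \<mu>: "0 \<le> \<mu>" "?J \<mu> = R"
    using IVT'[of ?J 0 R b] cont R b by auto
  then have "\<mu> > 0" using R by (cases "\<mu> = 0") auto
  then show ?thesis using \<mu> uniq by blast
qed

text \<open>
  By the chain rule the derivative is \<nu> (z/t) M(z) with z = x t^(-\<nu>), and \<nu> z M(z) = W(-z, -\<nu>, 0).
\<close>

lemma wright_profile_time_derivative:
  assumes "0 < \<nu>" "\<nu> < 1" "t > 0"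
  shows "((\<lambda>t. wright (- (x / t powr \<nu>)) (- \<nu>) 1) has_real_derivative wright_time \<nu> 0 x t) (at t)"
proof -
  have "((\<lambda>t. x / t powr \<nu>) has_real_derivative - (\<nu> * (x / t powr \<nu>) / t)) (at t)"
  proof -
    have "((\<lambda>t. x * t powr (- \<nu>)) has_real_derivative x * (- \<nu> * t powr (- \<nu> - 1))) (at t)"
      using assms by (intro DERIV_cmult has_real_derivative_powr) auto
    also have "x * (- \<nu> * t powr (- \<nu> - 1)) = - (\<nu> * (x / t powr \<nu>) / t)"
      using assms by (simp add: powr_diff powr_minus divide_inverse mult_ac)
    finally show ?thesis by (simp add: powr_minus divide_inverse)
  qed
  from DERIV_chain'[OF this wright_1_has_derivative[OF assms(1,2)]]
  show ?thesis
    using assms wright_0_eq_mainardi[OF assms(1,2), of "x / t powr \<nu>"]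
    by (simp add: wright_time_eq_wright powr_minus divide_inverse mult_ac)
qed

lemma abel_conv_powr:
  assumes "a > 0" "\<gamma> > 0" "t > 0"
  shows "set_integrable lborel {0<..<t} (\<lambda>\<tau>. (t - \<tau>) powr (\<gamma> - 1) * \<tau> powr (a - 1))"
    and "abel_conv \<gamma> (\<lambda>\<tau>. \<tau> powr (a - 1)) t = t powr (\<gamma> + a - 1) * Beta a \<gamma>"
proof -
  have eq: "indicator {0<..<1} r * ((1 - r) powr (\<gamma> - 1) * (t * r) powr (a - 1)) =
    t powr (a - 1) * (indicator {0..1} r *\<^sub>R (r powr (a - 1) * (1 - r) powr (\<gamma> - 1)))" for r :: real
    using assms by (cases "r = 0"; cases "r = 1") (auto simp: powr_mult split: split_indicator)
  have i: "set_integrable lborel {0..1} (\<lambda>t. t powr (a - 1) * (1 - t) powr (\<gamma> - 1))"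
    using assms by (intro integrable_Beta)
  show "set_integrable lborel {0<..<t} (\<lambda>\<tau>. (t - \<tau>) powr (\<gamma> - 1) * \<tau> powr (a - 1))"
    unfolding abel_conv_scaled(2)[OF assms(3), of _ "\<lambda>\<tau>. \<tau> powr (a - 1)"] eq
    using i by (intro integrable_mult_right) (simp add: set_integrable_def)
  have "(LINT r:{0..1}|lborel. r powr (a - 1) * (1 - r) powr (\<gamma> - 1)) = Beta a \<gamma>"
    using set_borel_integral_eq_integral(2)[OF i] has_integral_Beta_real[OF assms(1,2)]
    by (simp add: integral_unique)
  moreover have "t powr \<gamma> * t powr (a - 1) = t powr (\<gamma> + a - 1)"
    unfolding powr_add[symmetric] by (rule arg_cong) simp
  ultimately show "abel_conv \<gamma> (\<lambda>\<tau>. \<tau> powr (a - 1)) t = t powr (\<gamma> + a - 1) * Beta a \<gamma>"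
    unfolding abel_conv_scaled(1)[OF assms(3)] eq integral_mult_right_zero
    by (simp add: set_lebesgue_integral_def mult.assoc[symmetric])
qed

section \<open>The similarity solution\<close>

lemma caputo_from_derivative:
  assumes "\<And>\<tau>. \<tau> > 0 \<Longrightarrow> (f has_real_derivative c * g \<tau>) (at \<tau>)"
    and "set_integrable lborel {0<..<t} (\<lambda>\<tau>. (t - \<tau>) powr ((1 - \<alpha>) - 1) * g \<tau>)"
  shows "caputo_exists \<alpha> f t" "caputo \<alpha> f t = c / Gamma (1 - \<alpha>) * abel_conv (1 - \<alpha>) g t"
proof -
  have eq: "(t - \<tau>) powr (- \<alpha>) * deriv f \<tau> = c * ((t - \<tau>) powr ((1 - \<alpha>) - 1) * g \<tau>)"
    if "\<tau> \<in> {0<..<t}" for \<tau>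
    using DERIV_imp_deriv[OF assms(1), of \<tau>] that by simp
  have "set_integrable lborel {0<..<t} (\<lambda>\<tau>. (t - \<tau>) powr (- \<alpha>) * deriv f \<tau>) \<longleftrightarrow>
      set_integrable lborel {0<..<t} (\<lambda>\<tau>. c * ((t - \<tau>) powr ((1 - \<alpha>) - 1) * g \<tau>))"
    by (intro set_integrable_cong refl eq)
  moreover have "set_integrable lborel {0<..<t} (\<lambda>\<tau>. c * ((t - \<tau>) powr ((1 - \<alpha>) - 1) * g \<tau>))"
    by (intro set_integrable_mult_right assms(2))
  ultimately show "caputo_exists \<alpha> f t"
    using assms(1) unfolding caputo_exists_def field_differentiable_def by blast
  have "(LINT \<tau>:{0<..<t}|lborel. (t - \<tau>) powr (- \<alpha>) * deriv f \<tau>) =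
      (LINT \<tau>:{0<..<t}|lborel. c * ((t - \<tau>) powr ((1 - \<alpha>) - 1) * g \<tau>))"
    by (rule set_lebesgue_integral_cong) (use eq in auto)
  then show "caputo \<alpha> f t = c / Gamma (1 - \<alpha>) * abel_conv (1 - \<alpha>) g t"
    unfolding caputo_def abel_conv_def by simp
qed

text \<open>
  Here \<mu> is an arbitrary positive number: the fractional equation and the two conditions on u hold
  for each of them, and only the condition on the velocity of the free boundary selects the root.
\<close>

locale similarity_solution =
  fixes \<nu> l q C \<mu> :: real
  assumes \<nu>: "0 < \<nu>" "\<nu> < 1 / 2" and l: "l > 0" and q: "q > 0" and \<mu>: "\<mu> > 0"
begin

abbreviation G :: real where "G \<equiv> Gamma (1 - \<nu>)"

abbreviation u :: "real \<Rightarrow> real \<Rightarrow> real" where "u \<equiv> u2 (2 * \<nu>) l q C \<mu>"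

abbreviation s :: "real \<Rightarrow> real" where "s \<equiv> s2 (2 * \<nu>) l \<mu>"

abbreviation \<zeta> :: "real \<Rightarrow> real \<Rightarrow> real" where "\<zeta> x t \<equiv> x / l / t powr \<nu>"

lemma \<nu>1: "\<nu> < 1" using \<nu> by simp

lemma G_pos: "G > 0" using Gamma_real_pos[of "1 - \<nu>"] \<nu> by linarith

lemma u_eq: "u x t = C + q * l * G * (wright (- \<zeta> x t) (- \<nu>) 1 - wright (- \<mu>) (- \<nu>) 1)"
  by (simp add: u2_def algebra_simps)

lemma s_eq: "s t = l * \<mu> * t powr \<nu>"
  by (simp add: s2_def)

lemma s_pos: "t > 0 \<Longrightarrow> s t > 0"
  using l \<mu> by (simp add: s_eq)

lemma \<zeta>_s: "t > 0 \<Longrightarrow> \<zeta> (s t) t = \<mu>"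
  using l by (simp add: s_eq)

lemma \<zeta>_mono: "t > 0 \<Longrightarrow> x \<le> s t \<Longrightarrow> \<zeta> x t \<le> \<mu>"
  unfolding s_eq using l by (simp add: field_simps)

lemma \<zeta>_has_derivative: "((\<lambda>x. \<zeta> x t) has_real_derivative 1 / (l * t powr \<nu>)) (at x)"
proof -
  have "((\<lambda>x. 1 / (l * t powr \<nu>) * x) has_real_derivative 1 / (l * t powr \<nu>) * 1) (at x)"
    by (intro DERIV_cmult DERIV_ident)
  then show ?thesis by simp
qed

lemma u_has_space_derivative:
  assumes "t > 0"
  shows "((\<lambda>x. u x t) has_real_derivative - (q * G / t powr \<nu>) * mainardi \<nu> (\<zeta> x t)) (at x)"
proof -
  have "((\<lambda>x. wright (- \<zeta> x t) (- \<nu>) 1) has_real_derivative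
      1 / (l * t powr \<nu>) * - mainardi \<nu> (\<zeta> x t)) (at x)"
    using DERIV_chain'[OF \<zeta>_has_derivative wright_1_has_derivative[OF \<nu>(1) \<nu>1]] by (simp add: mult.commute)
  then have "((\<lambda>x. C + q * l * G * (wright (- \<zeta> x t) (- \<nu>) 1 - wright (- \<mu>) (- \<nu>) 1))
      has_real_derivative 0 + q * l * G * (1 / (l * t powr \<nu>) * - mainardi \<nu> (\<zeta> x t) - 0)) (at x)"
    by (intro DERIV_add DERIV_cmult DERIV_diff DERIV_const)
  then show ?thesis using l by (simp add: u_eq mult.assoc)
qed

lemma space_deriv_u:
  assumes "t > 0" "0 \<le> x" "x \<le> s t"
  shows "space_deriv s u x t = - (q * G / t powr \<nu>) * mainardi \<nu> (\<zeta> x t)"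
  unfolding space_deriv_def
proof (rule vector_derivative_within_closed_interval)
  show "((\<lambda>y. u y t) has_vector_derivative - (q * G / t powr \<nu>) * mainardi \<nu> (\<zeta> x t)) (at x within {0..s t})"
    using u_has_space_derivative[OF assms(1), of x]
    by (auto simp: has_real_derivative_iff_has_vector_derivative intro: has_vector_derivative_at_within)
qed (use assms s_pos in auto)

lemma space_deriv_has_derivative:
  assumes "0 < x" "x < s t" "t > 0"
  shows "((\<lambda>y. space_deriv s u y t) has_real_derivative
    q * G / (l * t powr (2 * \<nu>)) * wright (- \<zeta> x t) (- \<nu>) (1 - 2 * \<nu>)) (at x)"
proof (rule has_field_derivative_transform_within_open[where S = "{0<..<s t}"])
  have "((\<lambda>y. mainardi \<nu> (\<zeta> y t)) has_real_derivative
      - wright (- \<zeta> x t) (- \<nu>) (1 - 2 * \<nu>) * (1 / (l * t powr \<nu>))) (at x)"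
    using DERIV_chain'[OF \<zeta>_has_derivative mainardi_has_derivative[OF \<nu>(1) \<nu>1]]
    by (simp only: mult.commute[of "1 / (l * t powr \<nu>)"])
  then have "((\<lambda>y. - (q * G / t powr \<nu>) * mainardi \<nu> (\<zeta> y t)) has_real_derivative
      - (q * G / t powr \<nu>) * (- wright (- \<zeta> x t) (- \<nu>) (1 - 2 * \<nu>) * (1 / (l * t powr \<nu>)))) (at x)"
    by (rule DERIV_cmult)
  also have "- (q * G / t powr \<nu>) * (- wright (- \<zeta> x t) (- \<nu>) (1 - 2 * \<nu>) * (1 / (l * t powr \<nu>)))
     = q * G / (l * (t powr \<nu> * t powr \<nu>)) * wright (- \<zeta> x t) (- \<nu>) (1 - 2 * \<nu>)"
    by simp
  also have "t powr \<nu> * t powr \<nu> = t powr (2 * \<nu>)"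
    unfolding powr_add[symmetric] by simp
  finally show "((\<lambda>y. - (q * G / t powr \<nu>) * mainardi \<nu> (\<zeta> y t)) has_real_derivative
    q * G / (l * t powr (2 * \<nu>)) * wright (- \<zeta> x t) (- \<nu>) (1 - 2 * \<nu>)) (at x)" .
qed (use assms space_deriv_u in auto)

lemma space_deriv2_u:
  assumes "0 < x" "x < s t" "t > 0"
  shows "space_deriv2 s u x t = q * G / (l * t powr (2 * \<nu>)) * wright (- \<zeta> x t) (- \<nu>) (1 - 2 * \<nu>)"
  unfolding space_deriv2_def by (rule DERIV_imp_deriv[OF space_deriv_has_derivative[OF assms]])

lemma u_has_time_derivative:
  assumes "t > 0"
  shows "(u x has_real_derivative q * l * G * wright_time \<nu> 0 (x / l) t) (at t)"
proof -
  have "((\<lambda>t. C + q * l * G * (wright (- \<zeta> x t) (- \<nu>) 1 - wright (- \<mu>) (- \<nu>) 1))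
      has_real_derivative 0 + q * l * G * (wright_time \<nu> 0 (x / l) t - 0)) (at t)"
    by (intro DERIV_add DERIV_cmult DERIV_diff DERIV_const wright_profile_time_derivative \<nu> \<nu>1 assms)
  then show ?thesis by (simp add: u_eq[abs_def])
qed

lemma caputo_u:
  assumes "x > 0" "t > 0"
  shows "caputo_exists (2 * \<nu>) (u x) t"
    and "caputo (2 * \<nu>) (u x) t = q * l * G / t powr (2 * \<nu>) * wright (- \<zeta> x t) (- \<nu>) (1 - 2 * \<nu>)"
proof -
  have X: "x / l > 0" using assms l by simp
  obtain B where B: "\<And>t. t > 0 \<Longrightarrow> \<bar>wright_time \<nu> 0 (x / l) t\<bar> \<le> B"
    using wright_time_bounded[OF \<nu> _ X, of 0] by auto
  have i: "set_integrable lborel {0<..<t} (\<lambda>\<tau>. (t - \<tau>) powr ((1 - 2 * \<nu>) - 1) * wright_time \<nu> 0 (x / l) \<tau>)"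
    using \<nu> by (intro abel_conv_integrable[OF wright_time_measurable B _ assms(2)]) auto
  note c = caputo_from_derivative[OF u_has_time_derivative i]
  show "caputo_exists (2 * \<nu>) (u x) t" by (rule c(1))
  have "Gamma (1 - 2 * \<nu>) > 0" using Gamma_real_pos[of "1 - 2 * \<nu>"] \<nu> by linarith
  moreover have "abel_conv (1 - 2 * \<nu>) (wright_time \<nu> 0 (x / l)) t =
      Gamma (1 - 2 * \<nu>) * (t powr ((1 - 2 * \<nu>) - 1) * wright (- \<zeta> x t) (- \<nu>) (1 - 2 * \<nu>))"
    using \<nu> assms by (intro abel_conv_wright X) auto
  moreover have "t powr ((1 - 2 * \<nu>) - 1) = 1 / t powr (2 * \<nu>)"
    using powr_minus_divide[of t "2 * \<nu>"] by simp
  ultimately show "caputo (2 * \<nu>) (u x) t = q * l * G / t powr (2 * \<nu>) * wright (- \<zeta> x t) (- \<nu>) (1 - 2 * \<nu>)"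
    using c(2) by simp
qed

lemma s_has_derivative:
  assumes "t > 0"
  shows "(s has_real_derivative l * \<mu> * \<nu> * t powr (\<nu> - 1)) (at t)"
proof -
  have "((\<lambda>t. l * \<mu> * t powr \<nu>) has_real_derivative l * \<mu> * (\<nu> * t powr (\<nu> - 1))) (at t)"
    using assms by (intro DERIV_cmult has_real_derivative_powr) auto
  then show ?thesis by (simp add: s_eq[abs_def] mult.assoc)
qed

lemma caputo_s:
  assumes "t > 0"
  shows "caputo_exists (2 * \<nu>) s t"
    and "caputo (2 * \<nu>) s t = l * \<mu> * Gamma (1 + \<nu>) / (G * t powr \<nu>)"
proof -
  have p: "1 - 2 * \<nu> > 0" using \<nu> by simp
  note c = caputo_from_derivative[OF s_has_derivative abel_conv_powr(1)[OF \<nu>(1) p assms]]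
  show "caputo_exists (2 * \<nu>) s t" by (rule c(1))
  have "Gamma (1 - 2 * \<nu>) > 0" using Gamma_real_pos[OF p] .
  moreover have "Beta \<nu> (1 - 2 * \<nu>) = Gamma \<nu> * Gamma (1 - 2 * \<nu>) / G"
    unfolding Beta_def by simp
  moreover have "Gamma (1 + \<nu>) = \<nu> * Gamma \<nu>"
    using Gamma_plus1[of \<nu>] nonpos_Ints_nonpos[of \<nu>] \<nu> by (auto simp: add.commute)
  moreover have "t powr (1 - 2 * \<nu> + \<nu> - 1) = 1 / t powr \<nu>"
    using powr_minus_divide[of t \<nu>] by (simp add: algebra_simps)
  ultimately show "caputo (2 * \<nu>) s t = l * \<mu> * Gamma (1 + \<nu>) / (G * t powr \<nu>)"
    using c(2) abel_conv_powr(2)[OF \<nu>(1) p assms] by (simp add: mult_ac)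
qed

lemma u_bounds:
  assumes "0 \<le> x" "x \<le> s t" "t > 0"
  shows "C \<le> u x t" "u x t \<le> C + q * l * G * (1 - wright (- \<mu>) (- \<nu>) 1)"
proof -
  have z: "0 \<le> \<zeta> x t" "\<zeta> x t \<le> \<mu>" using assms l \<zeta>_mono by auto
  have c: "q * l * G \<ge> 0" using q l G_pos by simp
  show "C \<le> u x t"
    using wright_1_antimono[OF \<nu> z] c by (simp add: u_eq)
  have "wright (- \<zeta> x t) (- \<nu>) 1 \<le> 1"
    using wright_1_antimono[OF \<nu> order.refl z(1)] by (simp add: wright_0 rGamma_inverse_Gamma)
  then show "u x t \<le> C + q * l * G * (1 - wright (- \<mu>) (- \<nu>) 1)"
    unfolding u_eq using c by (intro add_left_mono mult_left_mono) auto
qed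

lemma stefan_problem_if_root:
  assumes k: "k > 0"
    and root: "\<mu> / mainardi \<nu> \<mu> = k * q / l * (G\<^sup>2 / Gamma (1 + \<nu>))"
  shows "stefan_problem (2 * \<nu>) l k q C u s"
  unfolding stefan_problem_def
proof (intro conjI allI impI; (elim conjE)?)
  fix t :: real assume t: "t > 0"
  show "s t > 0" by (rule s_pos[OF t])
  show "(\<lambda>x. u x t) differentiable_on {0..s t}"
    using u_has_space_derivative[OF t]
    by (intro differentiable_at_imp_differentiable_on) (auto simp: real_differentiable_def)
  show "space_deriv s u 0 t = - q / t powr (2 * \<nu> / 2)"
  proof -
    have "G * mainardi \<nu> 0 = 1"
      using G_pos by (simp add: mainardi_0 rGamma_inverse_Gamma)
    then have "q * G / t powr \<nu> * mainardi \<nu> 0 = q / t powr \<nu>" by simp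
    then show ?thesis using space_deriv_u[OF t, of 0] s_pos[OF t] by simp
  qed
  show "u (s t) t = C" using \<zeta>_s[OF t] by (simp add: u_eq)
  show "caputo_exists (2 * \<nu>) s t" by (rule caputo_s[OF t])
  have M: "mainardi \<nu> \<mu> > 0" using mainardi_pos[OF \<nu>, of \<mu>] \<mu> by simp
  have "Gamma (1 + \<nu>) > 0" using Gamma_real_pos[of "1 + \<nu>"] \<nu> by linarith
  then have "l * \<mu> * Gamma (1 + \<nu>) = k * q * G\<^sup>2 * mainardi \<nu> \<mu>"
    using root M l by (simp add: field_simps)
  then have "l * \<mu> * Gamma (1 + \<nu>) / (G * t powr \<nu>) = k * (q * G / t powr \<nu> * mainardi \<nu> \<mu>)"
    using G_pos t by (simp add: field_simps power2_eq_square)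
  then show "caputo (2 * \<nu>) s t = - k * space_deriv s u (s t) t"
    using caputo_s[OF t] space_deriv_u[OF t, of "s t"] s_pos[OF t] \<zeta>_s[OF t] by simp
  fix x assume x: "0 < x" "x < s t"
  show "caputo_exists (2 * \<nu>) (u x) t" by (rule caputo_u[OF x(1) t])
  show "(\<lambda>y. space_deriv s u y t) field_differentiable (at x)"
    using space_deriv_has_derivative[OF x t] by (auto simp: field_differentiable_def)
  show "caputo (2 * \<nu>) (u x) t = l\<^sup>2 * space_deriv2 s u x t"
    unfolding caputo_u(2)[OF x(1) t] space_deriv2_u[OF x t] using l by (simp add: power2_eq_square)
next
  show "s 0 = 0" by (simp add: s_eq)
qed

lemma \<zeta>_continuous_on: "(\<And>p. p \<in> S \<Longrightarrow> snd p > 0) \<Longrightarrow> continuous_on S (\<lambda>p. \<zeta> (fst p) (snd p))"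
  by (intro continuous_intros) (use l in force)+

lemma similarity_continuous_on:
  assumes "\<And>p. p \<in> S \<Longrightarrow> snd p > 0" "b \<le> 1"
  shows "continuous_on S (\<lambda>p. wright (- \<zeta> (fst p) (snd p)) (- \<nu>) b)"
proof (rule continuous_on_compose2[OF wright_continuous_on[of \<nu> b UNIV]])
  show "continuous_on S (\<lambda>p. - \<zeta> (fst p) (snd p))"
    by (intro continuous_on_minus \<zeta>_continuous_on assms)
qed (use assms \<nu> in auto)

lemma stefan_solution_above_if_root:
  assumes k: "k > 0" and T: "T > 0"
    and root: "\<mu> / mainardi \<nu> \<mu> = k * q / l * (G\<^sup>2 / Gamma (1 + \<nu>))"
  shows "stefan_solution_above C T (2 * \<nu>) l k q C u s"
proof -
  define D where "D = {(x, t). 0 < x \<and> x < s t \<and> 0 < t \<and> t < T}"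
  define D' where "D' = {(x, t). 0 \<le> x \<and> x \<le> s t \<and> 0 < t \<and> t < T}"
  have pD: "\<And>p. p \<in> D \<Longrightarrow> snd p > 0" and pD': "\<And>p. p \<in> D' \<Longrightarrow> snd p > 0"
    by (auto simp: D_def D'_def)
  have nz: "\<forall>p\<in>S. l * snd p powr (2 * \<nu>) \<noteq> 0" "\<forall>p\<in>S. snd p powr (2 * \<nu>) \<noteq> 0" "\<forall>p\<in>S. snd p powr \<nu> \<noteq> 0"
      "\<forall>p\<in>S. snd p \<noteq> 0"
    if "\<And>p. p \<in> S \<Longrightarrow> snd p > 0" for S :: "(real \<times> real) set"
    using that l by force+
  have c1: "continuous_on D (\<lambda>(x, t). space_deriv2 s u x t)"
  proof (rule continuous_on_eq)
    show "continuous_on D (\<lambda>p. q * G / (l * snd p powr (2 * \<nu>)) * wright (- \<zeta> (fst p) (snd p)) (- \<nu>) (1 - 2 * \<nu>))"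
      using \<nu> nz[OF pD] by (intro continuous_intros similarity_continuous_on pD) auto
  qed (auto simp: D_def space_deriv2_u)
  have c2: "continuous_on D (\<lambda>(x, t). caputo (2 * \<nu>) (u x) t)"
  proof (rule continuous_on_eq)
    show "continuous_on D (\<lambda>p. q * l * G / snd p powr (2 * \<nu>) * wright (- \<zeta> (fst p) (snd p)) (- \<nu>) (1 - 2 * \<nu>))"
      using \<nu> nz[OF pD] by (intro continuous_intros similarity_continuous_on pD) auto
  qed (auto simp: D_def caputo_u)
  have c3: "continuous_on D' (\<lambda>(x, t). u x t)"
  proof (rule continuous_on_eq)
    show "continuous_on D' (\<lambda>p. C + q * l * G * (wright (- \<zeta> (fst p) (snd p)) (- \<nu>) 1 - wright (- \<mu>) (- \<nu>) 1))"
      by (intro continuous_intros similarity_continuous_on pD') auto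
  qed (auto simp: u_eq)
  have c4: "continuous_on D' (\<lambda>(x, t). space_deriv s u x t)"
  proof (rule continuous_on_eq)
    show "continuous_on D' (\<lambda>p. - (q * G / snd p powr \<nu>) * mainardi \<nu> (\<zeta> (fst p) (snd p)))"
      unfolding mainardi_def
      using \<nu> nz[OF pD'] by (intro continuous_intros similarity_continuous_on pD') auto
  qed (auto simp: D'_def space_deriv_u)
  let ?F = "at (0, 0) within D"
  \<comment> \<open>Otherwise the punctured filter would be trivial and the lower limit would exceed the upper one.\<close>
  have "(0, 0) islimpt D"
    unfolding islimpt_sequential
  proof (intro exI[of _ "\<lambda>n. (s (T / (real n + 2)) / 2, T / (real n + 2))"] conjI allI)
    fix n :: nat
    have "T / (real n + 2) > 0" "T / (real n + 2) < T" using T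
      by (simp_all add: field_simps add_pos_nonneg)
    then show "(s (T / (real n + 2)) / 2, T / (real n + 2)) \<in> D - {(0, 0)}"
      using s_pos[of "T / (real n + 2)"] T by (auto simp: D_def)
  next
    have "(\<lambda>n. T / (real n + 2)) \<longlonglongrightarrow> 0" by real_asymp
    moreover have "(\<lambda>n. l * \<mu> * (T / (real n + 2)) powr \<nu> / 2) \<longlonglongrightarrow> 0" using T \<nu> by real_asymp
    ultimately show "(\<lambda>n. (s (T / (real n + 2)) / 2, T / (real n + 2))) \<longlonglongrightarrow> (0, 0)"
      unfolding s_eq by (intro tendsto_Pair)
  qed
  then have F: "\<not> trivial_limit ?F" by (simp add: trivial_limit_within)
  have ev: "\<forall>\<^sub>F p in ?F. P p" if "\<And>p. p \<in> D \<Longrightarrow> P p" for P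
    unfolding eventually_at_filter by (intro always_eventually) (use that in auto)
  have lo: "ereal C \<le> Liminf ?F (\<lambda>(x, t). ereal (u x t))"
    by (intro Liminf_bounded ev) (auto simp: D_def u_bounds(1))
  have "Limsup ?F (\<lambda>(x, t). ereal (u x t)) \<le> ereal (C + q * l * G * (1 - wright (- \<mu>) (- \<nu>) 1))"
  proof (intro Limsup_bounded ev)
    fix p assume "p \<in> D"
    then show "(case p of (x, t) \<Rightarrow> ereal (u x t)) \<le> ereal (C + q * l * G * (1 - wright (- \<mu>) (- \<nu>) 1))"
      using u_bounds(2)[of "fst p" "snd p"] by (auto simp: D_def)
  qed
  then have hi: "Limsup ?F (\<lambda>(x, t). ereal (u x t)) < \<infinity>"
    by (rule le_less_trans) simp
  have mid: "Liminf ?F (\<lambda>(x, t). ereal (u x t)) \<le> Limsup ?F (\<lambda>(x, t). ereal (u x t))"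
    by (rule Liminf_le_Limsup[OF F])
  have s1: "continuous_on {0..<T} s"
    unfolding s_eq[abs_def] using \<nu> by (intro continuous_intros continuous_on_powr') auto
  have ds: "deriv s t = l * \<mu> * \<nu> * t powr (\<nu> - 1)" if "t > 0" for t
    by (rule DERIV_imp_deriv[OF s_has_derivative[OF that]])
  have s2: "continuous_on {0<..<T} (deriv s)"
  proof (rule continuous_on_eq)
    show "continuous_on {0<..<T} (\<lambda>t. l * \<mu> * \<nu> * t powr (\<nu> - 1))"
      by (intro continuous_intros) auto
  qed (simp add: ds)
  have s3: "set_integrable lborel {0<..<t} (\<lambda>\<tau>. deriv s \<tau> / (t - \<tau>) powr (2 * \<nu>))" if "t > 0" for t
    using caputo_s(1)[OF that]
    by (simp add: caputo_exists_def powr_minus divide_inverse mult.commute)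
  show ?thesis
    unfolding stefan_solution_above_def Let_def
    using stefan_problem_if_root[OF k root] c1 c2 c3 c4 lo mid hi s1 s2 s3 s_has_derivative
    unfolding D_def D'_def by (auto simp: field_differentiable_def)
qed

end

lemma stefan_solution_above_mono:
  assumes "stefan_solution_above c T \<alpha> l k q C u s" "c' \<le> c"
  shows "stefan_solution_above c' T \<alpha> l k q C u s"
  using assms order_trans[of "ereal c'" "ereal c"] unfolding stefan_solution_above_def Let_def by auto

theorem mainTheorem3:
  fixes \<alpha> l k q C :: real
  assumes "0 < \<alpha>" and "\<alpha> < 1" and "l > 0" and "k > 0" and "q > 0"
  defines "R \<equiv> k * q / l * ((Gamma (1 - \<alpha> / 2))\<^sup>2 / Gamma (1 + \<alpha> / 2))"
  shows "(\<exists>!\<mu>. 0 < \<mu> \<and> stefan_J \<alpha> \<mu> = R) \<and>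
    (\<forall>\<mu>. 0 < \<mu> \<and> stefan_J \<alpha> \<mu> = R \<longrightarrow>
      (\<forall>T>0.
         (0 \<le> C \<longrightarrow> stefan_solution T \<alpha> l k q C (u2 \<alpha> l q C \<mu>) (s2 \<alpha> l \<mu>)) \<and>
         stefan_solution_above C T \<alpha> l k q C (u2 \<alpha> l q C \<mu>) (s2 \<alpha> l \<mu>)))"
proof -
  define \<nu> where "\<nu> = \<alpha> / 2"
  have \<alpha>: "\<alpha> = 2 * \<nu>" by (simp add: \<nu>_def)
  have \<nu>: "0 < \<nu>" "\<nu> < 1 / 2" using assms(1,2) by (auto simp: \<nu>_def)
  have R: "R = k * q / l * ((Gamma (1 - \<nu>))\<^sup>2 / Gamma (1 + \<nu>))" by (simp add: R_def \<nu>_def)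
  have "Gamma (1 - \<nu>) > 0" "Gamma (1 + \<nu>) > 0"
    using Gamma_real_pos[of "1 - \<nu>"] Gamma_real_pos[of "1 + \<nu>"] \<nu> by linarith+
  then have "R > 0" unfolding R using assms by simp
  have J: "stefan_J \<alpha> \<mu> = \<mu> / mainardi \<nu> \<mu>" for \<mu> by (simp add: stefan_J_def \<nu>_def)
  have above: "stefan_solution_above C T \<alpha> l k q C (u2 \<alpha> l q C \<mu>) (s2 \<alpha> l \<mu>)"
    if "0 < \<mu>" "stefan_J \<alpha> \<mu> = R" "T > 0" for \<mu> T
  proof -
    interpret similarity_solution \<nu> l q C \<mu>
      by unfold_locales (use \<nu> assms that in auto)
    show ?thesis
      unfolding \<alpha> using that(2) unfolding J R
      by (intro stefan_solution_above_if_root assms that)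
  qed
  show ?thesis
  proof (intro conjI allI impI; (elim conjE)?)
    show "\<exists>!\<mu>. 0 < \<mu> \<and> stefan_J \<alpha> \<mu> = R"
      unfolding J by (rule stefan_J_root[OF \<nu> \<open>R > 0\<close>])
    fix \<mu> T :: real assume *: "0 < \<mu>" "stefan_J \<alpha> \<mu> = R" "T > 0"
    show "stefan_solution_above C T \<alpha> l k q C (u2 \<alpha> l q C \<mu>) (s2 \<alpha> l \<mu>)"
      by (rule above[OF *])
    assume "0 \<le> C"
    then show "stefan_solution T \<alpha> l k q C (u2 \<alpha> l q C \<mu>) (s2 \<alpha> l \<mu>)"
      unfolding stefan_solution_def by (rule stefan_solution_above_mono[OF above[OF *]])
  qed
qed

end
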